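(* Let $N\ge 2$ and let $\Omega\subset\mathbb{R}^N$ be a bounded Lipschitz domain. The operator $$\Delta:H^2_0(\Omega)\longrightarrow(\mathscr{H}_{L^2(\Omega)})^\bot$$ is an isomorphism. That is, for any $f\in L^2(\Omega)$ satisfying $\int_\Omega f\varphi\,dx=0$ for all $\varphi\in\mathscr{H}_{L^2(\Omega)}$, there exists a unique $u\in H^2_0(\Omega)$ such that $\Delta u=f$ in $\Omega$.
   Context: $\mathscr{H}_{L^2(\Omega)}=\{v\in L^2(\Omega):\Delta v=0\text{ in }\Omega\}$ and $(\mathscr{H}_{L^2(\Omega)})^\bot=\{f\in L^2(\Omega):\int_\Omega f\varphi\,dx=0\ \forall\varphi\in\mathscr{H}_{L^2(\Omega)}\}$. Isomorphism means linear topological isomorphism. *)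

theory Defs
  imports "HOL-Analysis.Analysis"
begin

section \<open>Lipschitz domains\<close>

text \<open>Near each boundary point, and after a rotation taking the last coordinate axis to the
  direction \<^term>\<open>e\<close>, the set is the strict epigraph of a Lipschitz function of the remaining
  coordinates; \<^term>\<open>x - (x \<bullet> e) *\<^sub>R e\<close> is the projection to the hyperplane orthogonal to
  \<^term>\<open>e\<close>.\<close>

definition lipschitz_boundary :: "'a::euclidean_space set \<Rightarrow> bool" where
  "lipschitz_boundary \<Omega> \<longleftrightarrow>
     (\<forall>p\<in>frontier \<Omega>. \<exists>r>0. \<exists>e g L. norm e = 1 \<and> L-lipschitz_on {y. y \<bullet> e = 0} g \<and>
        \<Omega> \<inter> ball p r = {x \<in> ball p r. g (x - (x \<bullet> e) *\<^sub>R e) < x \<bullet> e})"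

definition bounded_lipschitz_domain :: "'a::euclidean_space set \<Rightarrow> bool" where
  "bounded_lipschitz_domain \<Omega> \<longleftrightarrow>
     \<Omega> \<noteq> {} \<and> open \<Omega> \<and> connected \<Omega> \<and> bounded \<Omega> \<and> lipschitz_boundary \<Omega>"

section \<open>Test functions\<close>

definition partial_deriv :: "'a::euclidean_space \<Rightarrow> ('a \<Rightarrow> real) \<Rightarrow> 'a \<Rightarrow> real" where
  "partial_deriv b f x = deriv (\<lambda>t::real. f (x + t *\<^sub>R b)) 0"

definition partial_derivs :: "'a::euclidean_space list \<Rightarrow> ('a \<Rightarrow> real) \<Rightarrow> 'a \<Rightarrow> real" where
  "partial_derivs bs f = foldr partial_deriv bs f"

definition laplacian :: "('a::euclidean_space \<Rightarrow> real) \<Rightarrow> 'a \<Rightarrow> real" where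
  "laplacian f x = (\<Sum>b\<in>Basis. partial_derivs [b, b] f x)"

primrec C_k :: "nat \<Rightarrow> ('a::euclidean_space \<Rightarrow> real) \<Rightarrow> bool" where
  "C_k 0 f \<longleftrightarrow> continuous_on UNIV f"
| "C_k (Suc k) f \<longleftrightarrow> f differentiable_on UNIV \<and> (\<forall>b\<in>Basis. C_k k (partial_deriv b f))"

definition test_functions :: "'a::euclidean_space set \<Rightarrow> ('a \<Rightarrow> real) set" where
  "test_functions \<Omega> = {\<phi>. (\<forall>k. C_k k \<phi>) \<and>
     compact (closure {x. \<phi> x \<noteq> 0}) \<and> closure {x. \<phi> x \<noteq> 0} \<subseteq> \<Omega>}"

section \<open>The space of square-integrable functions\<close>

text \<open>Elements are classes of functions modulo equality almost everywhere in \<^term>\<open>\<Omega>\<close>.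
  Values outside \<^term>\<open>\<Omega>\<close> are irrelevant: \<^term>\<open>lebesgue_on \<Omega>\<close> has space \<^term>\<open>\<Omega>\<close>.
  Operations on classes are computed on an arbitrary representative.\<close>

definition ae_class :: "'a::euclidean_space set \<Rightarrow> ('a \<Rightarrow> real) \<Rightarrow> ('a \<Rightarrow> real) set" where
  "ae_class \<Omega> f = {g \<in> borel_measurable (lebesgue_on \<Omega>). AE x in lebesgue_on \<Omega>. g x = f x}"

definition rep :: "('a \<Rightarrow> real) set \<Rightarrow> 'a \<Rightarrow> real" where
  "rep U = (SOME f. f \<in> U)"

definition L2 :: "'a::euclidean_space set \<Rightarrow> ('a \<Rightarrow> real) set set" where
  "L2 \<Omega> = ae_class \<Omega> ` {f \<in> borel_measurable (lebesgue_on \<Omega>).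
     integrable (lebesgue_on \<Omega>) (\<lambda>x. (f x)\<^sup>2)}"

definition class_add ::
  "'a::euclidean_space set \<Rightarrow> ('a \<Rightarrow> real) set \<Rightarrow> ('a \<Rightarrow> real) set \<Rightarrow> ('a \<Rightarrow> real) set" where
  "class_add \<Omega> U V = ae_class \<Omega> (\<lambda>x. rep U x + rep V x)"

definition class_scale ::
  "'a::euclidean_space set \<Rightarrow> real \<Rightarrow> ('a \<Rightarrow> real) set \<Rightarrow> ('a \<Rightarrow> real) set" where
  "class_scale \<Omega> c U = ae_class \<Omega> (\<lambda>x. c * rep U x)"

definition class_diff ::
  "'a::euclidean_space set \<Rightarrow> ('a \<Rightarrow> real) set \<Rightarrow> ('a \<Rightarrow> real) set \<Rightarrow> ('a \<Rightarrow> real) set" where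
  "class_diff \<Omega> U V = ae_class \<Omega> (\<lambda>x. rep U x - rep V x)"

definition L2_inner ::
  "'a::euclidean_space set \<Rightarrow> ('a \<Rightarrow> real) set \<Rightarrow> ('a \<Rightarrow> real) set \<Rightarrow> real" where
  "L2_inner \<Omega> U V = (LINT x|lebesgue_on \<Omega>. rep U x * rep V x)"

definition L2_norm :: "'a::euclidean_space set \<Rightarrow> ('a \<Rightarrow> real) set \<Rightarrow> real" where
  "L2_norm \<Omega> U = sqrt (L2_inner \<Omega> U U)"

definition L2_topology :: "'a::euclidean_space set \<Rightarrow> ('a \<Rightarrow> real) set topology" where
  "L2_topology \<Omega> = Metric_space.mtopology (L2 \<Omega>) (\<lambda>U V. L2_norm \<Omega> (class_diff \<Omega> U V))"

section \<open>Sobolev spaces of order two\<close>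

definition is_weak_deriv ::
  "'a::euclidean_space set \<Rightarrow> 'a list \<Rightarrow> ('a \<Rightarrow> real) set \<Rightarrow> ('a \<Rightarrow> real) set \<Rightarrow> bool" where
  "is_weak_deriv \<Omega> bs U G \<longleftrightarrow> G \<in> L2 \<Omega> \<and>
     (\<forall>\<phi>\<in>test_functions \<Omega>.
        (LINT x|lebesgue_on \<Omega>. rep U x * partial_derivs bs \<phi> x) =
        (-1) ^ length bs * (LINT x|lebesgue_on \<Omega>. rep G x * \<phi> x))"

definition weak_deriv ::
  "'a::euclidean_space set \<Rightarrow> 'a list \<Rightarrow> ('a \<Rightarrow> real) set \<Rightarrow> ('a \<Rightarrow> real) set" where
  "weak_deriv \<Omega> bs U = (THE G. is_weak_deriv \<Omega> bs U G)"

text \<open>The lists of coordinate directions of length at most two stand for the function itself,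
  its first-order and its second-order derivatives. Hence \<open>H2_norm\<close> uses all entries of
  the Hessian matrix, so each mixed derivative is counted twice.\<close>

definition directions2 :: "'a::euclidean_space list set" where
  "directions2 = {bs. set bs \<subseteq> Basis \<and> length bs \<le> 2}"

definition H2 :: "'a::euclidean_space set \<Rightarrow> ('a \<Rightarrow> real) set set" where
  "H2 \<Omega> = {U \<in> L2 \<Omega>. \<forall>bs\<in>directions2. \<exists>G. is_weak_deriv \<Omega> bs U G}"

definition H2_norm :: "'a::euclidean_space set \<Rightarrow> ('a \<Rightarrow> real) set \<Rightarrow> real" where
  "H2_norm \<Omega> U = sqrt (\<Sum>bs\<in>directions2. (L2_norm \<Omega> (weak_deriv \<Omega> bs U))\<^sup>2)"

definition H2_topology :: "'a::euclidean_space set \<Rightarrow> ('a \<Rightarrow> real) set topology" where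
  "H2_topology \<Omega> = Metric_space.mtopology (H2 \<Omega>) (\<lambda>U V. H2_norm \<Omega> (class_diff \<Omega> U V))"

definition H2_0 :: "'a::euclidean_space set \<Rightarrow> ('a \<Rightarrow> real) set set" where
  "H2_0 \<Omega> = H2_topology \<Omega> closure_of (ae_class \<Omega> ` test_functions \<Omega>)"

definition weak_laplacian ::
  "'a::euclidean_space set \<Rightarrow> ('a \<Rightarrow> real) set \<Rightarrow> ('a \<Rightarrow> real) set" where
  "weak_laplacian \<Omega> U = ae_class \<Omega> (\<lambda>x. \<Sum>b\<in>Basis. rep (weak_deriv \<Omega> [b, b] U) x)"

section \<open>Harmonic functions and the isomorphism property\<close>

text \<open>For a merely square-integrable function, harmonicity is meant in the sense of
  distributions.\<close>

definition harmonic_L2 :: "'a::euclidean_space set \<Rightarrow> ('a \<Rightarrow> real) set set" where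
  "harmonic_L2 \<Omega> = {V \<in> L2 \<Omega>. \<forall>\<phi>\<in>test_functions \<Omega>.
     (LINT x|lebesgue_on \<Omega>. rep V x * laplacian \<phi> x) = 0}"

definition harmonic_perp :: "'a::euclidean_space set \<Rightarrow> ('a \<Rightarrow> real) set set" where
  "harmonic_perp \<Omega> = {F \<in> L2 \<Omega>. \<forall>V\<in>harmonic_L2 \<Omega>. L2_inner \<Omega> F V = 0}"

definition linear_topological_iso :: "'a::euclidean_space set \<Rightarrow>
    ('a \<Rightarrow> real) set topology \<Rightarrow> ('a \<Rightarrow> real) set topology \<Rightarrow>
    (('a \<Rightarrow> real) set \<Rightarrow> ('a \<Rightarrow> real) set) \<Rightarrow> bool" where
  "linear_topological_iso \<Omega> X Y T \<longleftrightarrow>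
     (\<forall>U\<in>topspace X. \<forall>V\<in>topspace X. T (class_add \<Omega> U V) = class_add \<Omega> (T U) (T V)) \<and>
     (\<forall>c. \<forall>U\<in>topspace X. T (class_scale \<Omega> c U) = class_scale \<Omega> c (T U)) \<and>
     homeomorphic_map X Y T"

end

theory Submission
  imports Defs "HOL-Computational_Algebra.Polynomial"
begin

text \<open>
  For a test function \<open>\<phi>\<close>, two integrations by parts turn the integral of \<open>(\<Delta> \<phi>)\<^sup>2\<close> into the sum of the
  integrals of all \<open>(\<partial>\<^sub>i \<partial>\<^sub>j \<phi>)\<^sup>2\<close> (\<open>l2norm_laplacian\<close>), and on a bounded domain the Poincare inequality
  (\<open>Poincare\<close>) bounds the lower derivatives by the second ones. So the \<open>H2\<close> norm of \<open>\<phi>\<close> is at most a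
  constant times the \<open>L2\<close> norm of \<open>\<Delta> \<phi>\<close> (\<open>laplacian_bounds_derivs\<close>). By density the estimate holds for
  differences of elements of \<open>H2_0\<close> (\<open>H2_0_estimate\<close>), so the Laplacian is injective there and its
  inverse is Lipschitz; in the other direction it is Lipschitz by the triangle inequality.

  The range lies in the orthogonal complement of the harmonic functions, because a square-integrable
  function is harmonic exactly if it is orthogonal to the Laplacians of all test functions. For the same
  reason the range is everything: given \<open>F\<close> in the complement, project it onto the closure of the
  Laplacians of test functions (\<open>projection_onto_closure\<close>). The residual is harmonic, hence orthogonal to \<open>F\<close>
  and to the projection, hence zero. Thus \<open>F\<close> is a limit of Laplacians \<open>\<Delta> \<phi>\<^sub>n\<close>, the estimate makes \<open>\<phi>\<^sub>n\<close> a
  Cauchy sequence together with its derivatives, and its limit is the preimage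
  (\<open>laplacian_limit_attained\<close>).

  The analysis underneath is: completeness of \<open>L2\<close> (\<open>L2_complete\<close>), integration by parts, obtained from
  translation invariance of the integral (\<open>integral_partial_deriv_eq_0\<close>), and uniqueness of weak
  derivatives (\<open>AE_zero_of_orthogonal\<close>), which needs enough test functions.
\<close>

section \<open>Square-integrable functions\<close>

definition square_integrable :: "'b measure \<Rightarrow> ('b \<Rightarrow> real) \<Rightarrow> bool" where
  "square_integrable M f \<longleftrightarrow> f \<in> borel_measurable M \<and> integrable M (\<lambda>x. (f x)\<^sup>2)"

definition l2norm :: "'b measure \<Rightarrow> ('b \<Rightarrow> real) \<Rightarrow> real" where
  "l2norm M f = sqrt (LINT x|M. (f x)\<^sup>2)"

lemma square_integrable_measurable: "square_integrable M f \<Longrightarrow> f \<in> borel_measurable M"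
  by (simp add: square_integrable_def)

lemma l2norm_nonneg [simp]: "0 \<le> l2norm M f"
  by (simp add: l2norm_def)

lemma l2norm_power2: "(l2norm M f)\<^sup>2 = (LINT x|M. (f x)\<^sup>2)"
  by (simp add: l2norm_def)

lemma integrable_product:
  assumes "square_integrable M f" "square_integrable M g"
  shows "integrable M (\<lambda>x. f x * g x)"
proof (rule Bochner_Integration.integrable_bound)
  show "integrable M (\<lambda>x. (f x)\<^sup>2 + (g x)\<^sup>2)"
    using assms by (auto simp: square_integrable_def)
  show "(\<lambda>x. f x * g x) \<in> borel_measurable M"
    using assms by (auto simp: square_integrable_def)
  have "\<bar>a * b\<bar> \<le> a\<^sup>2 + b\<^sup>2" for a b :: real
  proof -
    have "0 \<le> (\<bar>a\<bar> - \<bar>b\<bar>)\<^sup>2" by simp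
    then have "2 * (\<bar>a\<bar> * \<bar>b\<bar>) \<le> a\<^sup>2 + b\<^sup>2" by (simp add: power2_diff)
    moreover have "0 \<le> \<bar>a\<bar> * \<bar>b\<bar>" by simp
    ultimately show ?thesis unfolding abs_mult by linarith
  qed
  then show "AE x in M. norm (f x * g x) \<le> norm ((f x)\<^sup>2 + (g x)\<^sup>2)"
    by simp
qed

lemma square_integrable_add:
  assumes "square_integrable M f" "square_integrable M g"
  shows "square_integrable M (\<lambda>x. f x + g x)"
  using assms integrable_product[OF assms] by (auto simp: square_integrable_def power2_sum mult.assoc)

lemma square_integrable_cmult:
  "square_integrable M f \<Longrightarrow> square_integrable M (\<lambda>x. c * f x)"
  by (auto simp: square_integrable_def power_mult_distrib)

lemma square_integrable_diff:
  assumes "square_integrable M f" "square_integrable M g"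
  shows "square_integrable M (\<lambda>x. f x - g x)"
  using square_integrable_add[OF assms(1) square_integrable_cmult[OF assms(2), of "-1"]] by simp

lemma square_integrable_zero [simp]: "square_integrable M (\<lambda>x. 0)"
  by (simp add: square_integrable_def)

lemma square_integrable_sum:
  assumes "\<And>i. i \<in> I \<Longrightarrow> square_integrable M (f i)"
  shows "square_integrable M (\<lambda>x. \<Sum>i\<in>I. f i x)"
  using assms by (induction I rule: infinite_finite_induct) (auto intro: square_integrable_add)

lemma l2norm_cong_AE:
  assumes "f \<in> borel_measurable M" "g \<in> borel_measurable M" "AE x in M. f x = g x"
  shows "l2norm M f = l2norm M g"
proof -
  have "(LINT x|M. (f x)\<^sup>2) = (LINT x|M. (g x)\<^sup>2)"
    by (rule integral_cong_AE) (use assms in auto)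
  then show ?thesis by (simp add: l2norm_def)
qed

lemma square_integrable_cong_AE:
  assumes "square_integrable M f" "g \<in> borel_measurable M" "AE x in M. f x = g x"
  shows "square_integrable M g"
proof -
  have "integrable M (\<lambda>x. (g x)\<^sup>2) = integrable M (\<lambda>x. (f x)\<^sup>2)"
    by (rule integrable_cong_AE) (use assms in \<open>auto simp: square_integrable_def\<close>)
  with assms show ?thesis by (simp add: square_integrable_def)
qed

lemma l2norm_eq_0_iff:
  assumes "square_integrable M f"
  shows "l2norm M f = 0 \<longleftrightarrow> (AE x in M. f x = 0)"
  using assms integral_nonneg_eq_0_iff_AE[of M "\<lambda>x. (f x)\<^sup>2"]
  by (auto simp: l2norm_def square_integrable_def)

lemma l2norm_cmult: "l2norm M (\<lambda>x. c * f x) = \<bar>c\<bar> * l2norm M f"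
  by (simp add: l2norm_def power_mult_distrib real_sqrt_mult)

lemma l2norm_minus_commute: "l2norm M (\<lambda>x. f x - g x) = l2norm M (\<lambda>x. g x - f x)"
  by (simp add: l2norm_def power2_commute)

lemma l2norm_diff_square:
  assumes f: "square_integrable M f" and g: "square_integrable M g"
  shows "(l2norm M (\<lambda>x. f x - c * g x))\<^sup>2
    = (l2norm M f)\<^sup>2 - 2 * c * (LINT x|M. f x * g x) + c\<^sup>2 * (l2norm M g)\<^sup>2"
proof -
  have "(LINT x|M. (f x - c * g x)\<^sup>2)
      = (LINT x|M. (f x)\<^sup>2 - 2 * c * (f x * g x) + c\<^sup>2 * (g x)\<^sup>2)"
    by (simp add: power2_diff algebra_simps)
  also have "\<dots> = (LINT x|M. (f x)\<^sup>2) - 2 * c * (LINT x|M. f x * g x) + c\<^sup>2 * (LINT x|M. (g x)\<^sup>2)"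
    using f g integrable_product[OF f g] by (simp add: square_integrable_def)
  finally show ?thesis by (simp add: l2norm_power2)
qed

text \<open>Near \<open>c = 0\<close> the linear term dominates; this is the vanishing of a first variation.\<close>

lemma nonneg_quadratic_slope_0:
  fixes T i :: real
  assumes T: "T \<ge> 0" and pos: "\<And>c. 0 \<le> - 2 * c * i + c\<^sup>2 * T"
  shows "i = 0"
proof (rule ccontr)
  assume "i \<noteq> 0"
  define c where "c = i / (T + 1)"
  have "i = c * (T + 1)" and c: "c \<noteq> 0" using T \<open>i \<noteq> 0\<close> by (auto simp: c_def)
  then have "- 2 * c * i + c\<^sup>2 * T = - (c\<^sup>2 * (T + 2))"
    by (simp add: algebra_simps power2_eq_square)
  moreover have "0 < c\<^sup>2 * (T + 2)" using c T by simp
  ultimately show False using pos[of c] by simp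
qed

lemma Cauchy_Schwarz_integral:
  assumes f: "square_integrable M f" and g: "square_integrable M g"
  shows "\<bar>LINT x|M. f x * g x\<bar> \<le> l2norm M f * l2norm M g"
proof -
  let ?i = "LINT x|M. f x * g x"
  have nonneg: "0 \<le> (l2norm M f)\<^sup>2 - 2 * c * ?i + c\<^sup>2 * (l2norm M g)\<^sup>2" for c
    using l2norm_diff_square[OF f g, of c] by (metis zero_le_power2)
  have "?i\<^sup>2 \<le> (l2norm M f)\<^sup>2 * (l2norm M g)\<^sup>2"
  proof (cases "l2norm M g = 0")
    case True
    \<comment> \<open>Then the quadratic is affine in \<open>c\<close> and bounded below, so its slope vanishes.\<close>
    have "?i = 0"
    proof (rule ccontr)
      assume "?i \<noteq> 0"
      then show False
        using nonneg[of "((l2norm M f)\<^sup>2 + 1) / (2 * ?i)"] True by (simp add: field_simps)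
    qed
    then show ?thesis by simp
  next
    case False
    have "((l2norm M g)\<^sup>2) * ((l2norm M f)\<^sup>2 - 2 * (?i / (l2norm M g)\<^sup>2) * ?i
        + (?i / (l2norm M g)\<^sup>2)\<^sup>2 * (l2norm M g)\<^sup>2)
       = (l2norm M f)\<^sup>2 * (l2norm M g)\<^sup>2 - ?i\<^sup>2"
      using False by (simp add: field_simps power2_eq_square)
    moreover have "0 \<le> ((l2norm M g)\<^sup>2) * ((l2norm M f)\<^sup>2 - 2 * (?i / (l2norm M g)\<^sup>2) * ?i
        + (?i / (l2norm M g)\<^sup>2)\<^sup>2 * (l2norm M g)\<^sup>2)"
      by (rule mult_nonneg_nonneg[OF zero_le_power2 nonneg])
    ultimately show ?thesis by simp
  qed
  then have "\<bar>?i\<bar>\<^sup>2 \<le> (l2norm M f * l2norm M g)\<^sup>2"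
    by (simp add: power_mult_distrib)
  then show ?thesis
    by (rule power2_le_imp_le) simp
qed

lemma l2norm_mono:
  assumes "square_integrable M f" "square_integrable M g" "AE x in M. \<bar>f x\<bar> \<le> \<bar>g x\<bar>"
  shows "l2norm M f \<le> l2norm M g"
proof -
  have "(LINT x|M. (f x)\<^sup>2) \<le> (LINT x|M. (g x)\<^sup>2)"
    using assms by (intro integral_mono_AE) (auto simp: square_integrable_def abs_le_square_iff)
  then show ?thesis by (simp add: l2norm_def)
qed

lemma l2norm_triangle:
  assumes f: "square_integrable M f" and g: "square_integrable M g"
  shows "l2norm M (\<lambda>x. f x + g x) \<le> l2norm M f + l2norm M g"
proof (rule power2_le_imp_le)
  have "(l2norm M (\<lambda>x. f x + g x))\<^sup>2
      = (l2norm M f)\<^sup>2 + 2 * (LINT x|M. f x * g x) + (l2norm M g)\<^sup>2"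
    using l2norm_diff_square[OF f g, of "-1"] by simp
  also have "\<dots> \<le> (l2norm M f + l2norm M g)\<^sup>2"
    using Cauchy_Schwarz_integral[OF f g] by (simp add: power2_sum)
  finally show "(l2norm M (\<lambda>x. f x + g x))\<^sup>2 \<le> (l2norm M f + l2norm M g)\<^sup>2" .
qed simp

lemma l2norm_triangle_diff:
  assumes "square_integrable M f" "square_integrable M g" "square_integrable M h"
  shows "l2norm M (\<lambda>x. f x - h x) \<le> l2norm M (\<lambda>x. f x - g x) + l2norm M (\<lambda>x. g x - h x)"
  using l2norm_triangle[OF square_integrable_diff[OF assms(1,2)] square_integrable_diff[OF assms(2,3)]]
  by simp

lemma l2norm_triangle_rev:
  assumes "square_integrable M f" "square_integrable M g"
  shows "\<bar>l2norm M f - l2norm M g\<bar> \<le> l2norm M (\<lambda>x. f x - g x)"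
  using l2norm_triangle[OF square_integrable_diff[OF assms] assms(2)]
    l2norm_triangle[OF square_integrable_diff[OF assms(2,1)] assms(1)] l2norm_minus_commute[of M f g]
  by simp

lemma l2norm_tendsto:
  assumes "\<And>n. square_integrable M (f n)" "square_integrable M g"
    and "(\<lambda>n. l2norm M (\<lambda>x. f n x - g x)) \<longlonglongrightarrow> 0"
  shows "(\<lambda>n. l2norm M (f n)) \<longlonglongrightarrow> l2norm M g"
proof -
  have "(\<lambda>n. l2norm M (f n) - l2norm M g) \<longlonglongrightarrow> 0"
    by (rule Lim_null_comparison[OF _ assms(3)]) (use l2norm_triangle_rev[OF assms(1,2)] in simp)
  then show ?thesis by (simp add: LIM_zero_iff)
qed

lemma integral_product_tendsto:
  assumes f: "\<And>n. square_integrable M (f n)" and g: "square_integrable M g"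
    and lim: "(\<lambda>n. l2norm M (\<lambda>x. f n x - g x)) \<longlonglongrightarrow> 0" and h: "square_integrable M h"
  shows "(\<lambda>n. LINT x|M. f n x * h x) \<longlonglongrightarrow> (LINT x|M. g x * h x)"
proof -
  have eq: "(LINT x|M. f n x * h x) - (LINT x|M. g x * h x) = (LINT x|M. (f n x - g x) * h x)" for n
    using integrable_product[OF f h] integrable_product[OF g h]
    by (simp add: left_diff_distrib)
  have "(\<lambda>n. (LINT x|M. f n x * h x) - (LINT x|M. g x * h x)) \<longlonglongrightarrow> 0"
  proof (rule Lim_null_comparison)
    show "\<forall>\<^sub>F n in sequentially. norm ((LINT x|M. f n x * h x) - (LINT x|M. g x * h x))
        \<le> l2norm M (\<lambda>x. f n x - g x) * l2norm M h"
      unfolding eq using Cauchy_Schwarz_integral[OF square_integrable_diff[OF f g] h] by simp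
    show "(\<lambda>n. l2norm M (\<lambda>x. f n x - g x) * l2norm M h) \<longlonglongrightarrow> 0"
      using tendsto_mult_right[OF lim, of "l2norm M h"] by simp
  qed
  then show ?thesis by (simp add: LIM_zero_iff)
qed

lemma (in finite_measure) square_integrable_const: "square_integrable M (\<lambda>x. c)"
  by (simp add: square_integrable_def)

lemma l2norm_sum_limit:
  assumes "finite I" and f: "\<And>i n. i \<in> I \<Longrightarrow> square_integrable M (f i n)"
    and g: "\<And>i. i \<in> I \<Longrightarrow> square_integrable M (g i)"
    and lim: "\<And>i. i \<in> I \<Longrightarrow> (\<lambda>n. l2norm M (\<lambda>x. f i n x - g i x)) \<longlonglongrightarrow> 0"
  shows "(\<lambda>n. l2norm M (\<lambda>x. (\<Sum>i\<in>I. f i n x) - (\<Sum>i\<in>I. g i x))) \<longlonglongrightarrow> 0"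
  using assms
proof (induction I rule: finite_induct)
  case empty
  then show ?case by (simp add: l2norm_def)
next
  case (insert j I)
  let ?S = "\<lambda>n x. (\<Sum>i\<in>I. f i n x) - (\<Sum>i\<in>I. g i x)"
  have sq: "square_integrable M (?S n)" for n
    by (intro square_integrable_diff square_integrable_sum) (use insert in auto)
  have eq: "(\<Sum>i\<in>insert j I. f i n x) - (\<Sum>i\<in>insert j I. g i x) = (f j n x - g j x) + ?S n x" for n x
    using insert by simp
  show ?case unfolding eq
  proof (rule Lim_null_comparison)
    show "\<forall>\<^sub>F n in sequentially. norm (l2norm M (\<lambda>x. (f j n x - g j x) + ?S n x))
      \<le> l2norm M (\<lambda>x. f j n x - g j x) + l2norm M (?S n)"
      using l2norm_triangle[OF square_integrable_diff sq] insert by simp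
    show "(\<lambda>n. l2norm M (\<lambda>x. f j n x - g j x) + l2norm M (?S n)) \<longlonglongrightarrow> 0"
      using tendsto_add[of "\<lambda>n. l2norm M (\<lambda>x. f j n x - g j x)" 0 _ "\<lambda>n. l2norm M (?S n)" 0] insert by simp
  qed
qed

text \<open>On a finite measure space an \<open>L2\<close> Cauchy sequence is Cauchy in \<open>L1\<close>, so a subsequence converges
  almost everywhere, and its pointwise limit is the limit in \<open>L2\<close>.\<close>

lemma (in finite_measure) L2_complete:
  assumes f: "\<And>n. square_integrable M (f n)"
    and cauchy: "\<And>e. e > 0 \<Longrightarrow> \<exists>N. \<forall>m\<ge>N. \<forall>n\<ge>N. l2norm M (\<lambda>x. f m x - f n x) < e"
  obtains g where "square_integrable M g" "(\<lambda>n. l2norm M (\<lambda>x. f n x - g x)) \<longlonglongrightarrow> 0"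
proof -
  have fm [measurable]: "f n \<in> borel_measurable M" for n
    using f by (simp add: square_integrable_def)
  have int: "integrable M (f n)" for n
    using integrable_product[OF f square_integrable_const[of 1]] by simp
  have L1: "(LINT x|M. norm (f i x - f j x)) \<le> l2norm M (\<lambda>x. f i x - f j x) * l2norm M (\<lambda>x. 1)" for i j
  proof -
    have "square_integrable M (\<lambda>x. \<bar>f i x - f j x\<bar>)"
      using square_integrable_diff[OF f f, of i j] by (auto simp: square_integrable_def)
    from Cauchy_Schwarz_integral[OF this square_integrable_const[of 1]]
    have "\<bar>LINT x|M. \<bar>f i x - f j x\<bar>\<bar> \<le> l2norm M (\<lambda>x. \<bar>f i x - f j x\<bar>) * l2norm M (\<lambda>x. 1)"
      by simp
    moreover have "l2norm M (\<lambda>x. \<bar>f i x - f j x\<bar>) = l2norm M (\<lambda>x. f i x - f j x)"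
      by (simp add: l2norm_def)
    ultimately show ?thesis by simp
  qed
  have cauchy1: "\<exists>N. \<forall>i\<ge>N. \<forall>j\<ge>N. (LINT x|M. norm (f i x - f j x)) < e" if e: "e > 0" for e
  proof -
    have pos: "0 < l2norm M (\<lambda>x. 1) + 1"
      using l2norm_nonneg[of M "\<lambda>x. 1"] by linarith
    obtain N where N: "\<forall>m\<ge>N. \<forall>n\<ge>N. l2norm M (\<lambda>x. f m x - f n x) < e / (l2norm M (\<lambda>x. 1) + 1)"
      using cauchy[OF divide_pos_pos[OF e pos]] by blast
    have "(LINT x|M. norm (f i x - f j x)) < e" if "i \<ge> N" "j \<ge> N" for i j
    proof -
      have "(LINT x|M. norm (f i x - f j x)) \<le> l2norm M (\<lambda>x. f i x - f j x) * (l2norm M (\<lambda>x. 1) + 1)"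
        by (rule order_trans[OF L1]) (simp add: algebra_simps)
      also have "\<dots> < e"
        using N[rule_format, OF that] pos by (simp only: pos_less_divide_eq)
      finally show ?thesis .
    qed
    then show ?thesis by blast
  qed
  obtain r where r: "strict_mono r" "AE x in M. Cauchy (\<lambda>i. f (r i) x)"
    using cauchy_L1_AE_cauchy_subseq[of M f, OF int cauchy1] by blast
  define g where "g = (\<lambda>x. lim (\<lambda>i. f (r i) x))"
  have gm [measurable]: "g \<in> borel_measurable M"
    unfolding g_def by measurable
  have lim: "AE x in M. (\<lambda>i. f (r i) x) \<longlonglongrightarrow> g x"
    using r(2) by eventually_elim (simp add: g_def Cauchy_convergent_iff convergent_LIMSEQ_iff)
  \<comment> \<open>Fatou's lemma along the subsequence turns the Cauchy estimate into an estimate for the limit.\<close>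
  have key: "integrable M (\<lambda>x. (f n x - g x)\<^sup>2) \<and> l2norm M (\<lambda>x. f n x - g x) \<le> e"
    if N: "\<forall>m\<ge>N. \<forall>n\<ge>N. l2norm M (\<lambda>x. f m x - f n x) < e" and n: "n \<ge> N" and e: "e > 0" for n N e
  proof -
    have "(\<integral>\<^sup>+x. ennreal ((f n x - g x)\<^sup>2) \<partial>M) = (\<integral>\<^sup>+x. liminf (\<lambda>i. ennreal ((f n x - f (r i) x)\<^sup>2)) \<partial>M)"
    proof (rule nn_integral_cong_AE)
      show "AE x in M. ennreal ((f n x - g x)\<^sup>2) = liminf (\<lambda>i. ennreal ((f n x - f (r i) x)\<^sup>2))"
        using lim
      proof eventually_elim
        case (elim x)
        have "(\<lambda>i. ennreal ((f n x - f (r i) x)\<^sup>2)) \<longlonglongrightarrow> ennreal ((f n x - g x)\<^sup>2)"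
          by (intro tendsto_intros elim)
        then show ?case by (rule lim_imp_Liminf[OF sequentially_bot, symmetric])
      qed
    qed
    also have "\<dots> \<le> liminf (\<lambda>i. \<integral>\<^sup>+x. ennreal ((f n x - f (r i) x)\<^sup>2) \<partial>M)"
      by (rule nn_integral_liminf) measurable
    also have "\<dots> \<le> ennreal (e\<^sup>2)"
    proof (rule Liminf_le)
      show "\<forall>\<^sub>F i in sequentially. (\<integral>\<^sup>+x. ennreal ((f n x - f (r i) x)\<^sup>2) \<partial>M) \<le> ennreal (e\<^sup>2)"
        unfolding eventually_sequentially
      proof (intro exI[of _ N] allI impI)
        fix i assume "N \<le> i"
        then have "r i \<ge> N" using seq_suble[OF r(1), of i] by linarith
        then have "l2norm M (\<lambda>x. f n x - f (r i) x) \<le> e" using N n by (simp add: less_imp_le)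
        then have "(l2norm M (\<lambda>x. f n x - f (r i) x))\<^sup>2 \<le> e\<^sup>2" by (simp add: power_mono)
        moreover have "(\<integral>\<^sup>+x. ennreal ((f n x - f (r i) x)\<^sup>2) \<partial>M)
            = ennreal (LINT x|M. (f n x - f (r i) x)\<^sup>2)"
          by (rule nn_integral_eq_integral)
             (use square_integrable_diff[OF f f, of n "r i"] in \<open>auto simp: square_integrable_def\<close>)
        ultimately show "(\<integral>\<^sup>+x. ennreal ((f n x - f (r i) x)\<^sup>2) \<partial>M) \<le> ennreal (e\<^sup>2)"
          by (simp add: l2norm_power2 ennreal_leI)
      qed
    qed simp
    finally have le: "(\<integral>\<^sup>+x. ennreal ((f n x - g x)\<^sup>2) \<partial>M) \<le> ennreal (e\<^sup>2)" .
    have int: "integrable M (\<lambda>x. (f n x - g x)\<^sup>2)"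
      by (rule integrableI_bounded) (use le_less_trans[OF le ennreal_less_top] in simp_all)
    have "ennreal (LINT x|M. (f n x - g x)\<^sup>2) \<le> ennreal (e\<^sup>2)"
      using le nn_integral_eq_integral[OF int] by simp
    then have "(l2norm M (\<lambda>x. f n x - g x))\<^sup>2 \<le> e\<^sup>2"
      by (simp add: l2norm_power2)
    then have "l2norm M (\<lambda>x. f n x - g x) \<le> e" by (rule power2_le_imp_le) (use e in simp)
    then show ?thesis using int by simp
  qed
  have "square_integrable M g"
  proof -
    obtain N where "\<forall>m\<ge>N. \<forall>n\<ge>N. l2norm M (\<lambda>x. f m x - f n x) < 1" using cauchy[of 1] by auto
    then have "square_integrable M (\<lambda>x. f N x - g x)"
      using key[of N 1 N] by (simp add: square_integrable_def)
    from square_integrable_diff[OF f[of N] this] show ?thesis by simp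
  qed
  moreover have "(\<lambda>n. l2norm M (\<lambda>x. f n x - g x)) \<longlonglongrightarrow> 0"
  proof (rule LIMSEQ_I)
    fix e :: real assume e: "0 < e"
    obtain N where N: "\<forall>m\<ge>N. \<forall>n\<ge>N. l2norm M (\<lambda>x. f m x - f n x) < e / 2" using cauchy[OF half_gt_zero[OF e]] by blast
    show "\<exists>no. \<forall>n\<ge>no. norm (l2norm M (\<lambda>x. f n x - g x) - 0) < e"
    proof (intro exI[of _ N] allI impI)
      fix n assume "N \<le> n"
      then have "l2norm M (\<lambda>x. f n x - g x) \<le> e / 2" using key[OF N] e by simp
      then show "norm (l2norm M (\<lambda>x. f n x - g x) - 0) < e" using e by simp
    qed
  qed
  ultimately show thesis by (rule that)
qed

text \<open>A minimising sequence for the distance to a linear space \<open>S\<close> is Cauchy by the parallelogram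
  law; minimality makes the first variation vanish.\<close>

lemma (in finite_measure) projection_onto_closure:
  assumes F: "square_integrable M F"
    and S: "\<And>s. s \<in> S \<Longrightarrow> square_integrable M s" and "(\<lambda>x. 0) \<in> S"
    and add: "\<And>s t. s \<in> S \<Longrightarrow> t \<in> S \<Longrightarrow> (\<lambda>x. s x + t x) \<in> S"
    and scale: "\<And>c s. s \<in> S \<Longrightarrow> (\<lambda>x. c * s x) \<in> S"
  shows "\<exists>s p. (\<forall>n. s n \<in> S) \<and> square_integrable M p \<and>
    (\<lambda>n::nat. l2norm M (\<lambda>x. s n x - p x)) \<longlonglongrightarrow> 0 \<and>
    (\<forall>t\<in>S. (LINT x|M. (F x - p x) * t x) = 0)"
proof -
  define D where "D = (\<lambda>s. (l2norm M (\<lambda>x. F x - s x))\<^sup>2) ` S"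
  define d where "d = Inf D"
  have bdd: "bdd_below D" unfolding D_def by (intro bdd_belowI[of _ 0]) auto
  have ne: "D \<noteq> {}" using assms(3) by (auto simp: D_def)
  have dle: "d \<le> (l2norm M (\<lambda>x. F x - s x))\<^sup>2" if "s \<in> S" for s
    unfolding d_def using that bdd by (intro cInf_lower) (auto simp: D_def)
  have "\<exists>s\<in>S. (l2norm M (\<lambda>x. F x - s x))\<^sup>2 < d + 1 / Suc n" for n
  proof -
    have "Inf D < d + 1 / Suc n" by (simp add: d_def)
    then obtain y where "y \<in> D" "y < d + 1 / Suc n" using cInf_lessD[OF ne] by blast
    then show ?thesis by (auto simp: D_def)
  qed
  then obtain s where s: "\<And>n. s n \<in> S" and sd: "\<And>n. (l2norm M (\<lambda>x. F x - s n x))\<^sup>2 < d + 1 / Suc n"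
    by metis
  have sq: "square_integrable M (s n)" for n using S s by blast
  have para: "(l2norm M (\<lambda>x. s m x - s n x))\<^sup>2 \<le> 2 / Suc m + 2 / Suc n" for m n
  proof -
    let ?h = "\<lambda>x. (1/2) * (s m x + s n x)"
    have h: "?h \<in> S" by (intro scale add s)
    have "(LINT x|M. (s m x - s n x)\<^sup>2)
        = (LINT x|M. 2 * (F x - s m x)\<^sup>2 + 2 * (F x - s n x)\<^sup>2 - 4 * (F x - ?h x)\<^sup>2)"
      by (rule Bochner_Integration.integral_cong) (auto simp: power2_eq_square field_simps)
    also have "\<dots> = 2 * (LINT x|M. (F x - s m x)\<^sup>2) + 2 * (LINT x|M. (F x - s n x)\<^sup>2)
        - 4 * (LINT x|M. (F x - ?h x)\<^sup>2)"
    proof -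
      have "integrable M (\<lambda>x. (F x - u x)\<^sup>2)" if "u \<in> S" for u
        using square_integrable_diff[OF F S[OF that]] by (simp add: square_integrable_def)
      from this[OF s[of m]] this[OF s[of n]] this[OF h]
      have "integrable M (\<lambda>x. (F x - s m x)\<^sup>2)" "integrable M (\<lambda>x. (F x - s n x)\<^sup>2)"
        "integrable M (\<lambda>x. (F x - ?h x)\<^sup>2)" .
      then show ?thesis by simp
    qed
    finally have "(l2norm M (\<lambda>x. s m x - s n x))\<^sup>2 = 2 * (l2norm M (\<lambda>x. F x - s m x))\<^sup>2
       + 2 * (l2norm M (\<lambda>x. F x - s n x))\<^sup>2 - 4 * (l2norm M (\<lambda>x. F x - ?h x))\<^sup>2"
      unfolding l2norm_power2 .
    then show ?thesis using sd[of m] sd[of n] dle[OF h] by simp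
  qed
  have cauchy: "\<exists>N. \<forall>m\<ge>N. \<forall>n\<ge>N. l2norm M (\<lambda>x. s m x - s n x) < e" if e: "e > 0" for e
  proof -
    obtain N where N: "4 / e\<^sup>2 < real N" using reals_Archimedean2 by blast
    have "l2norm M (\<lambda>x. s m x - s n x) < e" if "m \<ge> N" "n \<ge> N" for m n
    proof (rule power2_less_imp_less)
      have Npos: "0 < real N" using N e by (intro less_trans[OF _ N]) simp
      have "2 / Suc m + 2 / Suc n \<le> 2 / N + 2 / N"
        using that Npos by (intro add_mono divide_left_mono) auto
      also have "\<dots> = 4 / N" by simp
      also have "\<dots> < e\<^sup>2" using N e Npos by (simp add: field_simps)
      finally show "(l2norm M (\<lambda>x. s m x - s n x))\<^sup>2 < e\<^sup>2" using para[of m n] by linarith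
    qed (use e in simp)
    then show ?thesis by blast
  qed
  obtain p where p: "square_integrable M p" and lim: "(\<lambda>n. l2norm M (\<lambda>x. s n x - p x)) \<longlonglongrightarrow> 0"
    using L2_complete[of s, OF sq cauchy] by blast
  have orth: "(LINT x|M. (F x - p x) * t x) = 0" if t: "t \<in> S" for t
  proof -
    let ?i = "LINT x|M. (F x - p x) * t x" and ?T = "(l2norm M t)\<^sup>2"
    have r: "square_integrable M (\<lambda>x. F x - p x)" by (rule square_integrable_diff[OF F p])
    have pos: "0 \<le> - 2 * c * ?i + c\<^sup>2 * ?T" for c
    proof -
      have "(\<lambda>n. l2norm M (\<lambda>x. F x - (s n x + c * t x))) \<longlonglongrightarrow> l2norm M (\<lambda>x. F x - p x - c * t x)"
      proof (rule l2norm_tendsto)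
        show "square_integrable M (\<lambda>x. F x - (s n x + c * t x))" for n
          by (intro square_integrable_diff square_integrable_add square_integrable_cmult F sq S t)
        show "square_integrable M (\<lambda>x. F x - p x - c * t x)"
          by (intro square_integrable_diff square_integrable_cmult F p S t)
        have "F x - (s n x + c * t x) - (F x - p x - c * t x) = p x - s n x" for n x by simp
        then show "(\<lambda>n. l2norm M (\<lambda>x. F x - (s n x + c * t x) - (F x - p x - c * t x))) \<longlonglongrightarrow> 0"
          using lim l2norm_minus_commute[of M p] by simp
      qed
      then have "(\<lambda>n. (l2norm M (\<lambda>x. F x - (s n x + c * t x)))\<^sup>2)
          \<longlonglongrightarrow> (l2norm M (\<lambda>x. F x - p x - c * t x))\<^sup>2"
        by (rule tendsto_power)
      then have "d \<le> (l2norm M (\<lambda>x. F x - p x - c * t x))\<^sup>2"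
        by (rule LIMSEQ_le_const) (intro exI[of _ 0] allI impI dle add[OF s scale[OF t]])
      moreover have "(l2norm M (\<lambda>x. F x - p x))\<^sup>2 \<le> d"
      proof (rule LIMSEQ_le)
        have "(\<lambda>n. l2norm M (\<lambda>x. F x - s n x)) \<longlonglongrightarrow> l2norm M (\<lambda>x. F x - p x)"
        proof (rule l2norm_tendsto)
          show "(\<lambda>n. l2norm M (\<lambda>x. F x - s n x - (F x - p x))) \<longlonglongrightarrow> 0"
            using lim l2norm_minus_commute[of M p] by simp
        qed (intro square_integrable_diff F sq p)+
        then show "(\<lambda>n. (l2norm M (\<lambda>x. F x - s n x))\<^sup>2) \<longlonglongrightarrow> (l2norm M (\<lambda>x. F x - p x))\<^sup>2"
          by (rule tendsto_power)
        show "(\<lambda>n. d + 1 / Suc n) \<longlonglongrightarrow> d"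
          using tendsto_add[OF tendsto_const[of d] LIMSEQ_inverse_real_of_nat]
          by (simp add: inverse_eq_divide)
      qed (use sd in \<open>auto intro: less_imp_le\<close>)
      ultimately show ?thesis using l2norm_diff_square[OF r S[OF t], of c] by simp
    qed
    show ?thesis
      by (rule nonneg_quadratic_slope_0[of ?T]) (use pos in auto)
  qed
  show ?thesis using s p lim orth by (intro exI[of _ s] exI[of _ p]) simp
qed

section \<open>Partial derivatives\<close>

lemma has_real_derivative_line:
  assumes "(f has_derivative D) (at (x + s *\<^sub>R b))"
  shows "((\<lambda>t::real. f (x + t *\<^sub>R b)) has_real_derivative (D b :: real)) (at s)"
proof -
  have "((\<lambda>t. x + t *\<^sub>R b) has_derivative (\<lambda>h. h *\<^sub>R b)) (at s)"
    by (auto intro!: derivative_eq_intros)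
  from diff_chain_at[OF this assms]
  have "((\<lambda>t. f (x + t *\<^sub>R b)) has_derivative (\<lambda>h. D (h *\<^sub>R b))) (at s)"
    by (simp add: o_def)
  moreover have "(\<lambda>h. D (h *\<^sub>R b)) = (*) (D b)"
    using linear_cmul[OF has_derivative_linear[OF assms]] by (simp add: fun_eq_iff mult.commute)
  ultimately show ?thesis by (simp add: has_field_derivative_def)
qed

lemma partial_deriv_eq:
  assumes "(f has_derivative D) (at x)"
  shows "partial_deriv b f x = D b"
  unfolding partial_deriv_def
  by (rule DERIV_imp_deriv[OF has_real_derivative_line]) (use assms in simp)

lemma has_real_derivative_partial_deriv:
  assumes "f differentiable_on UNIV"
  shows "((\<lambda>t::real. f (x + t *\<^sub>R b)) has_real_derivative partial_deriv b f (x + s *\<^sub>R b)) (at s)"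
proof -
  from assms obtain D where "(f has_derivative D) (at (x + s *\<^sub>R b))"
    by (auto simp: differentiable_on_def differentiable_def)
  then show ?thesis using has_real_derivative_line partial_deriv_eq by metis
qed

lemma partial_deriv_add:
  assumes "f differentiable_on UNIV" "g differentiable_on UNIV"
  shows "partial_deriv b (\<lambda>x. f x + g x) = (\<lambda>x. partial_deriv b f x + partial_deriv b g x)"
proof
  fix x
  obtain D E where D: "(f has_derivative D) (at x)" and E: "(g has_derivative E) (at x)"
    using assms unfolding differentiable_on_def differentiable_def by (metis UNIV_I)
  show "partial_deriv b (\<lambda>x. f x + g x) x = partial_deriv b f x + partial_deriv b g x"
    unfolding partial_deriv_eq[OF D] partial_deriv_eq[OF E]
    using partial_deriv_eq[OF has_derivative_add[OF D E]] by simp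
qed

lemma partial_deriv_mult:
  assumes "f differentiable_on UNIV" "g differentiable_on UNIV"
  shows "partial_deriv b (\<lambda>x. f x * g x)
    = (\<lambda>x. partial_deriv b f x * g x + f x * partial_deriv b g x)"
proof
  fix x
  obtain D E where D: "(f has_derivative D) (at x)" and E: "(g has_derivative E) (at x)"
    using assms unfolding differentiable_on_def differentiable_def by (metis UNIV_I)
  show "partial_deriv b (\<lambda>x. f x * g x) x = partial_deriv b f x * g x + f x * partial_deriv b g x"
    unfolding partial_deriv_eq[OF D] partial_deriv_eq[OF E]
    using partial_deriv_eq[OF has_derivative_mult[OF D E]] by simp
qed

lemma partial_deriv_const [simp]: "partial_deriv b (\<lambda>x. c) = (\<lambda>x. 0)"
  by (simp add: partial_deriv_def fun_eq_iff)

lemma partial_deriv_cmult: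
  assumes "f differentiable_on UNIV"
  shows "partial_deriv b (\<lambda>x. c * f x) = (\<lambda>x. c * partial_deriv b f x)"
  using partial_deriv_mult[of "\<lambda>x. c", OF _ assms] by simp

lemma C_k_Suc_imp_C_k: "C_k (Suc k) f \<Longrightarrow> C_k k f"
proof (induction k arbitrary: f)
  case 0
  then show ?case by (simp add: differentiable_imp_continuous_on)
next
  case (Suc k)
  from Suc.prems have "f differentiable_on UNIV" "\<forall>b\<in>Basis. C_k (Suc k) (partial_deriv b f)"
    unfolding C_k.simps(2)[of "Suc k"] by blast+
  with Suc.IH show ?case unfolding C_k.simps(2)[of k] by blast
qed

lemma C_k_const: "C_k k (\<lambda>x. c)"
  by (induction k arbitrary: c) auto

lemma C_k_add: "C_k k f \<Longrightarrow> C_k k g \<Longrightarrow> C_k k (\<lambda>x. f x + g x)"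
  by (induction k arbitrary: f g) (auto intro: continuous_on_add differentiable_on_add simp: partial_deriv_add)

lemma C_k_mult: "C_k k f \<Longrightarrow> C_k k g \<Longrightarrow> C_k k (\<lambda>x. f x * g x)"
proof (induction k arbitrary: f g)
  case 0
  then show ?case by (auto intro: continuous_on_mult)
next
  case (Suc k)
  then have "C_k k f" "C_k k g" using C_k_Suc_imp_C_k by blast+
  with Suc show ?case by (auto simp: partial_deriv_mult intro!: C_k_add differentiable_on_mult)
qed

lemma C_k_prod:
  assumes "\<And>i. i \<in> I \<Longrightarrow> C_k k (f i)"
  shows "C_k k (\<lambda>x. \<Prod>i\<in>I. f i x)"
  using assms by (induction I rule: infinite_finite_induct) (auto intro: C_k_const C_k_mult)

lemma second_difference:
  assumes f: "f differentiable_on UNIV" and fb: "partial_deriv b f differentiable_on UNIV" and h: "0 < h"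
  shows "\<exists>s t. 0 < s \<and> s < h \<and> 0 < t \<and> t < h \<and>
    f (x + h *\<^sub>R b + h *\<^sub>R c) - f (x + h *\<^sub>R b) - f (x + h *\<^sub>R c) + f x
     = h\<^sup>2 * partial_deriv c (partial_deriv b f) (x + s *\<^sub>R b + t *\<^sub>R c)"
proof -
  let ?g = "\<lambda>s. f ((x + h *\<^sub>R c) + s *\<^sub>R b) - f (x + s *\<^sub>R b)"
  have "(?g has_real_derivative
      partial_deriv b f ((x + h *\<^sub>R c) + s *\<^sub>R b) - partial_deriv b f (x + s *\<^sub>R b)) (at s)" for s
    by (intro DERIV_diff has_real_derivative_partial_deriv f)
  from MVT2[OF h this] obtain s where s: "0 < s" "s < h" and
    eq1: "?g h - ?g 0 = h * (partial_deriv b f ((x + h *\<^sub>R c) + s *\<^sub>R b) - partial_deriv b f (x + s *\<^sub>R b))"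
    by auto
  have "((\<lambda>t. partial_deriv b f ((x + s *\<^sub>R b) + t *\<^sub>R c)) has_real_derivative
     partial_deriv c (partial_deriv b f) ((x + s *\<^sub>R b) + t *\<^sub>R c)) (at t)" for t
    by (rule has_real_derivative_partial_deriv[OF fb])
  from MVT2[OF h this] obtain t where t: "0 < t" "t < h" and
    eq2: "partial_deriv b f ((x + s *\<^sub>R b) + h *\<^sub>R c) - partial_deriv b f (x + s *\<^sub>R b)
      = h * partial_deriv c (partial_deriv b f) ((x + s *\<^sub>R b) + t *\<^sub>R c)"
    by auto
  have "?g h - ?g 0 = h\<^sup>2 * partial_deriv c (partial_deriv b f) ((x + s *\<^sub>R b) + t *\<^sub>R c)"
    using eq1 eq2 by (simp add: algebra_simps power2_eq_square)
  then show ?thesis using s t by (intro exI[of _ s] exI[of _ t]) (simp add: algebra_simps)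
qed

text \<open>The second difference is symmetric in the two directions, and by the mean value theorem, divided by
  \<open>h\<^sup>2\<close>, it is the value of either mixed derivative at some point within distance of order \<open>h\<close>.\<close>

lemma partial_deriv_commute:
  assumes f: "C_k 2 f" and b: "b \<in> Basis" and c: "c \<in> Basis"
  shows "partial_deriv b (partial_deriv c f) x = partial_deriv c (partial_deriv b f) x"
proof -
  define h where "h n = inverse (real (Suc n))" for n
  have hpos: "h n > 0" for n by (simp add: h_def)
  have hlim: "h \<longlonglongrightarrow> 0" unfolding h_def by (rule LIMSEQ_inverse_real_of_nat)
  have ck: "C_k (Suc (Suc 0)) f" using f by (simp add: numeral_2_eq_2)
  then have df: "f differentiable_on UNIV" "partial_deriv b f differentiable_on UNIV"
    "partial_deriv c f differentiable_on UNIV"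
    using b c by auto
  have cont: "isCont (partial_deriv b (partial_deriv c f)) x" "isCont (partial_deriv c (partial_deriv b f)) x"
    using ck b c by (auto simp: continuous_on_eq_continuous_at)
  have "\<forall>n. \<exists>s t. 0 < s \<and> s < h n \<and> 0 < t \<and> t < h n \<and>
    f (x + h n *\<^sub>R b + h n *\<^sub>R c) - f (x + h n *\<^sub>R b) - f (x + h n *\<^sub>R c) + f x
     = (h n)\<^sup>2 * partial_deriv c (partial_deriv b f) (x + s *\<^sub>R b + t *\<^sub>R c)"
    using second_difference[OF df(1,2) hpos] by blast
  then obtain s t where st: "\<And>n. 0 < s n \<and> s n < h n \<and> 0 < t n \<and> t n < h n"
    and st_eq: "\<And>n. f (x + h n *\<^sub>R b + h n *\<^sub>R c) - f (x + h n *\<^sub>R b) - f (x + h n *\<^sub>R c) + f x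
     = (h n)\<^sup>2 * partial_deriv c (partial_deriv b f) (x + s n *\<^sub>R b + t n *\<^sub>R c)"
    by metis
  have "\<forall>n. \<exists>s t. 0 < s \<and> s < h n \<and> 0 < t \<and> t < h n \<and>
    f (x + h n *\<^sub>R c + h n *\<^sub>R b) - f (x + h n *\<^sub>R c) - f (x + h n *\<^sub>R b) + f x
     = (h n)\<^sup>2 * partial_deriv b (partial_deriv c f) (x + s *\<^sub>R c + t *\<^sub>R b)"
    using second_difference[OF df(1,3) hpos] by blast
  then obtain s' t' where st': "\<And>n. 0 < s' n \<and> s' n < h n \<and> 0 < t' n \<and> t' n < h n"
    and st'_eq: "\<And>n. f (x + h n *\<^sub>R c + h n *\<^sub>R b) - f (x + h n *\<^sub>R c) - f (x + h n *\<^sub>R b) + f x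
     = (h n)\<^sup>2 * partial_deriv b (partial_deriv c f) (x + s' n *\<^sub>R c + t' n *\<^sub>R b)"
    by metis
  have eq: "partial_deriv c (partial_deriv b f) (x + s n *\<^sub>R b + t n *\<^sub>R c)
      = partial_deriv b (partial_deriv c f) (x + s' n *\<^sub>R c + t' n *\<^sub>R b)" for n
  proof -
    have "(h n)\<^sup>2 * partial_deriv c (partial_deriv b f) (x + s n *\<^sub>R b + t n *\<^sub>R c)
      = (h n)\<^sup>2 * partial_deriv b (partial_deriv c f) (x + s' n *\<^sub>R c + t' n *\<^sub>R b)"
      unfolding st_eq[symmetric] st'_eq[symmetric] by (simp add: algebra_simps)
    then show ?thesis using hpos[of n] by simp
  qed
  have lim0: "u \<longlonglongrightarrow> 0" if "\<And>n. 0 < u n \<and> u n < h n" for u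
    by (rule tendsto_sandwich[OF _ _ tendsto_const hlim])
      (use that in \<open>auto intro: less_imp_le always_eventually\<close>)
  have "(\<lambda>n. x + s n *\<^sub>R b + t n *\<^sub>R c) \<longlonglongrightarrow> x + 0 *\<^sub>R b + 0 *\<^sub>R c"
    by (intro tendsto_intros lim0) (use st in auto)
  then have l1: "(\<lambda>n. partial_deriv c (partial_deriv b f) (x + s n *\<^sub>R b + t n *\<^sub>R c))
      \<longlonglongrightarrow> partial_deriv c (partial_deriv b f) x"
    by (intro isCont_tendsto_compose[OF cont(2)]) simp
  have "(\<lambda>n. x + s' n *\<^sub>R c + t' n *\<^sub>R b) \<longlonglongrightarrow> x + 0 *\<^sub>R c + 0 *\<^sub>R b"
    by (intro tendsto_intros lim0) (use st' in auto)
  then have l2: "(\<lambda>n. partial_deriv b (partial_deriv c f) (x + s' n *\<^sub>R c + t' n *\<^sub>R b))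
      \<longlonglongrightarrow> partial_deriv b (partial_deriv c f) x"
    by (intro isCont_tendsto_compose[OF cont(1)]) simp
  show ?thesis using l1 l2 unfolding eq by (rule LIMSEQ_unique[symmetric])
qed

lemma partial_deriv_support:
  "{x. partial_deriv b f x \<noteq> 0} \<subseteq> closure {x. f x \<noteq> 0}"
proof (rule subsetI, rule ccontr)
  fix x assume x: "x \<in> {x. partial_deriv b f x \<noteq> 0}" and "x \<notin> closure {x. f x \<noteq> 0}"
  then have "x \<in> - closure {x. f x \<noteq> 0}" by simp
  have "((\<lambda>y. 0) has_derivative (\<lambda>h. 0)) (at x)" by simp
  then have "(f has_derivative (\<lambda>h. 0)) (at x)"
  proof (rule has_derivative_transform_within_open)
    show "open (- closure {x. f x \<noteq> 0})" by (rule open_Compl[OF closed_closure])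
    show "0 = f y" if "y \<in> - closure {x. f x \<noteq> 0}" for y
      using that closure_subset[of "{x. f x \<noteq> 0}"] by auto
  qed fact
  from partial_deriv_eq[OF this] x show False by simp
qed

lemma integrable_compact_support:
  fixes f :: "'a::euclidean_space \<Rightarrow> real"
  assumes "continuous_on UNIV f" "compact (closure {x. f x \<noteq> 0})"
  shows "integrable lborel f"
proof -
  have "integrable lborel (\<lambda>x. indicator (closure {x. f x \<noteq> 0}) x *\<^sub>R f x)"
    by (intro borel_integrable_compact assms continuous_on_subset[OF assms(1)]) simp
  moreover have "(\<lambda>x. indicator (closure {x. f x \<noteq> 0}) x *\<^sub>R f x) = f"
    using closure_subset[of "{x. f x \<noteq> 0}"] by (auto simp: fun_eq_iff indicator_def)
  ultimately show ?thesis by simp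
qed

text \<open>By translation invariance every difference quotient has integral zero; dominated
  convergence passes this to the derivative, without an iterated integral.\<close>

lemma integral_partial_deriv_eq_0:
  fixes f :: "'a::euclidean_space \<Rightarrow> real"
  assumes f: "f differentiable_on UNIV" and cont: "continuous_on UNIV (partial_deriv b f)"
    and supp: "compact (closure {x. f x \<noteq> 0})"
  shows "(LINT x|lborel. partial_deriv b f x) = 0"
proof -
  define h where "h n = inverse (real (Suc n))" for n
  define q where "q n x = (f (x + h n *\<^sub>R b) - f x) / h n" for n x
  have hpos: "h n > 0" and h1: "h n \<le> 1" for n by (auto simp: h_def divide_simps)
  have hlim: "h \<longlonglongrightarrow> 0" unfolding h_def by (rule LIMSEQ_inverse_real_of_nat)
  have cf: "continuous_on UNIV f" by (rule differentiable_imp_continuous_on[OF f])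
  have int: "integrable lborel f" by (rule integrable_compact_support[OF cf supp])
  obtain R where R: "\<And>x. f x \<noteq> 0 \<Longrightarrow> norm x \<le> R"
    using compact_imp_bounded[OF supp] closure_subset[of "{x. f x \<noteq> 0}"]
    by (metis (mono_tags, lifting) bounded_iff mem_Collect_eq subsetD)
  have "bounded (partial_deriv b f ` closure {x. f x \<noteq> 0})"
    by (intro compact_imp_bounded compact_continuous_image supp continuous_on_subset[OF cont]) simp
  then obtain B where B': "\<And>x. x \<in> closure {x. f x \<noteq> 0} \<Longrightarrow> \<bar>partial_deriv b f x\<bar> \<le> B"
    by (auto simp: bounded_iff)
  have B: "\<bar>partial_deriv b f x\<bar> \<le> max B 0" for x
    using B'[of x] partial_deriv_support[of b f] by (cases "partial_deriv b f x = 0") (auto simp: le_max_iff_disj)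
  let ?w = "\<lambda>x. indicator (cball 0 (R + norm b)) x * max B 0"
  have "(\<lambda>n. LINT x|lborel. q n x) \<longlonglongrightarrow> (LINT x|lborel. partial_deriv b f x)"
  proof (rule integral_dominated_convergence[where w = ?w])
    show "partial_deriv b f \<in> borel_measurable lborel"
      using borel_measurable_continuous_onI[OF cont] by simp
    have [measurable]: "f \<in> borel_measurable borel" using borel_measurable_continuous_onI[OF cf] .
    show "q n \<in> borel_measurable lborel" for n unfolding q_def by measurable
    show "integrable lborel ?w"
      by (intro integrable_mult_left integrable_real_indicator) (simp_all add: emeasure_bounded_finite[unfolded infinity_ennreal_def])
    show "AE x in lborel. (\<lambda>n. q n x) \<longlonglongrightarrow> partial_deriv b f x"
    proof (rule AE_I2)
      fix x
      have "((\<lambda>t. f (x + t *\<^sub>R b)) has_real_derivative partial_deriv b f x) (at 0)"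
        using has_real_derivative_partial_deriv[OF f, of x b 0] by simp
      then have "((\<lambda>t. (f (x + t *\<^sub>R b) - f x) / t) \<longlongrightarrow> partial_deriv b f x) (at 0)"
        by (simp add: DERIV_def)
      moreover have "filterlim h (at 0) sequentially"
        using hlim hpos by (intro filterlim_atI) (auto intro!: always_eventually simp: less_imp_neq[symmetric])
      ultimately show "(\<lambda>n. q n x) \<longlonglongrightarrow> partial_deriv b f x"
        unfolding q_def by (rule filterlim_compose)
    qed
    show "AE x in lborel. norm (q n x) \<le> ?w x" for n
    proof (rule AE_I2)
      fix x
      have "((\<lambda>t. f (x + t *\<^sub>R b)) has_real_derivative partial_deriv b f (x + s *\<^sub>R b)) (at s)" for s
        by (rule has_real_derivative_partial_deriv[OF f])
      from MVT2[OF hpos this] obtain s where "f (x + h n *\<^sub>R b) - f (x + 0 *\<^sub>R b)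
          = (h n - 0) * partial_deriv b f (x + s *\<^sub>R b)" by blast
      then have "q n x = partial_deriv b f (x + s *\<^sub>R b)" using hpos[of n] by (simp add: q_def)
      then have le: "\<bar>q n x\<bar> \<le> max B 0" using B by simp
      show "norm (q n x) \<le> ?w x"
      proof (cases "norm x \<le> R + norm b")
        case True
        then show ?thesis using le by simp
      next
        case False
        then have "f x = 0" using R[of x] norm_ge_zero[of b] by linarith
        moreover have "f (x + h n *\<^sub>R b) = 0"
        proof (rule ccontr)
          assume "f (x + h n *\<^sub>R b) \<noteq> 0"
          then have "norm (x + h n *\<^sub>R b) \<le> R" by (rule R)
          moreover have "norm x \<le> norm (x + h n *\<^sub>R b) + norm (h n *\<^sub>R b)"
            by (metis add_diff_cancel norm_triangle_ineq4)
          moreover have "norm (h n *\<^sub>R b) \<le> norm b"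
            using h1[of n] hpos[of n] by (simp add: mult_left_le_one_le)
          ultimately show False using False by linarith
        qed
        ultimately show ?thesis by (simp add: q_def)
      qed
    qed
  qed
  moreover have "(LINT x|lborel. q n x) = 0" for n
  proof -
    have [measurable]: "f \<in> borel_measurable borel" using borel_measurable_continuous_onI[OF cf] .
    have "integrable (distr lborel borel ((+) (h n *\<^sub>R b))) f" using int by (simp add: lborel_distr_plus)
    then have int': "integrable lborel (\<lambda>x. f (x + h n *\<^sub>R b))"
      by (subst (asm) integrable_distr_eq) (simp_all add: add.commute)
    have "(LINT x|lborel. f x) = (LINT x|distr lborel borel ((+) (h n *\<^sub>R b)). f x)"
      by (simp add: lborel_distr_plus)
    also have "\<dots> = (LINT x|lborel. f (x + h n *\<^sub>R b))"
      by (subst integral_distr) (simp_all add: add.commute)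
    finally show ?thesis using int int' by (simp add: q_def)
  qed
  ultimately have "(\<lambda>n::nat. 0::real) \<longlonglongrightarrow> (LINT x|lborel. partial_deriv b f x)" by simp
  then show ?thesis by (simp add: LIMSEQ_const_iff)
qed

section \<open>Smooth functions and test functions\<close>

definition smooth :: "('a::euclidean_space \<Rightarrow> real) \<Rightarrow> bool" where
  "smooth f \<longleftrightarrow> (\<forall>k. C_k k f)"

lemma smooth_differentiable: "smooth f \<Longrightarrow> f differentiable_on UNIV"
  unfolding smooth_def using C_k.simps(2) by blast

lemma smooth_continuous: "smooth f \<Longrightarrow> continuous_on UNIV f"
  unfolding smooth_def using C_k.simps(1) by blast

lemma smooth_partial_deriv: "smooth f \<Longrightarrow> b \<in> Basis \<Longrightarrow> smooth (partial_deriv b f)"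
  unfolding smooth_def using C_k.simps(2) by blast

lemma smooth_const: "smooth (\<lambda>x. c)"
  by (simp add: smooth_def C_k_const)

lemma smooth_add: "smooth f \<Longrightarrow> smooth g \<Longrightarrow> smooth (\<lambda>x. f x + g x)"
  by (simp add: smooth_def C_k_add)

lemma smooth_mult: "smooth f \<Longrightarrow> smooth g \<Longrightarrow> smooth (\<lambda>x. f x * g x)"
  by (simp add: smooth_def C_k_mult)

lemma smooth_cmult: "smooth f \<Longrightarrow> smooth (\<lambda>x. c * f x)"
  by (intro smooth_mult smooth_const)

lemma smooth_sum: "(\<And>i. i \<in> I \<Longrightarrow> smooth (f i)) \<Longrightarrow> smooth (\<lambda>x. \<Sum>i\<in>I. f i x)"
  by (induction I rule: infinite_finite_induct) (auto intro: smooth_const smooth_add)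

lemma smooth_prod: "(\<And>i. i \<in> I \<Longrightarrow> smooth (f i)) \<Longrightarrow> smooth (\<lambda>x. \<Prod>i\<in>I. f i x)"
  by (simp add: smooth_def C_k_prod)

lemma partial_deriv_chain:
  assumes f: "f differentiable_on UNIV" and h: "\<And>t. (h has_real_derivative h' t) (at t)"
  shows "(\<lambda>x. h (f x)) differentiable_on UNIV"
    and "partial_deriv b (\<lambda>x. h (f x)) = (\<lambda>x. partial_deriv b f x * h' (f x))"
proof -
  have *: "\<exists>D. (f has_derivative D) (at x) \<and> ((\<lambda>x. h (f x)) has_derivative (\<lambda>v. h' (f x) * D v)) (at x)" for x
  proof -
    obtain D where D: "(f has_derivative D) (at x)"
      using f unfolding differentiable_on_def differentiable_def by (metis UNIV_I)
    have "((\<lambda>x. h (f x)) has_derivative (\<lambda>v. h' (f x) * D v)) (at x)"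
      using diff_chain_at[OF D] h[of "f x"] by (simp add: has_field_derivative_def o_def)
    with D show ?thesis by blast
  qed
  then show "(\<lambda>x. h (f x)) differentiable_on UNIV"
    unfolding differentiable_on_def differentiable_def by blast
  show "partial_deriv b (\<lambda>x. h (f x)) = (\<lambda>x. partial_deriv b f x * h' (f x))"
  proof
    fix x
    obtain D where D: "(f has_derivative D) (at x)"
      and C: "((\<lambda>x. h (f x)) has_derivative (\<lambda>v. h' (f x) * D v)) (at x)" using * by blast
    show "partial_deriv b (\<lambda>x. h (f x)) x = partial_deriv b f x * h' (f x)"
      unfolding partial_deriv_eq[OF D] partial_deriv_eq[OF C] by simp
  qed
qed

text \<open>A family of real functions closed under differentiation consists of smooth functions; closure is
  what makes the induction on the order of differentiability go through.\<close>

lemma smooth_compose: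
  assumes S: "\<And>h. h \<in> S \<Longrightarrow> \<exists>h'\<in>S. \<forall>t. (h has_real_derivative h' t) (at t)"
    and h: "h \<in> S" and f: "smooth f"
  shows "smooth (\<lambda>x. h (f x))"
  unfolding smooth_def
proof
  fix k show "C_k k (\<lambda>x. h (f x))"
    using h
  proof (induction k arbitrary: h)
    case 0
    then obtain h' where "\<And>t. (h has_real_derivative h' t) (at t)" using S by blast
    from differentiable_imp_continuous_on[OF partial_deriv_chain(1)[OF smooth_differentiable[OF f] this]]
    show ?case by simp
  next
    case (Suc k)
    then obtain h' where h': "h' \<in> S" "\<And>t. (h has_real_derivative h' t) (at t)" using S by blast
    have "C_k k (partial_deriv b (\<lambda>x. h (f x)))" if "b \<in> Basis" for b
      unfolding partial_deriv_chain(2)[OF smooth_differentiable[OF f] h'(2)]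
      using Suc.IH[OF h'(1)] smooth_partial_deriv[OF f that] by (intro C_k_mult) (simp_all add: smooth_def)
    then show ?case
      using partial_deriv_chain(1)[OF smooth_differentiable[OF f] h'(2)] by simp
  qed
qed

lemma smooth_exp: "smooth f \<Longrightarrow> smooth (\<lambda>x. exp (f x))"
  by (rule smooth_compose[of "{exp}" exp f]) (auto intro: DERIV_exp)

lemma smooth_affine: "smooth (\<lambda>x. m * (x \<bullet> i) + c)"
proof -
  have D: "((\<lambda>x. m * (x \<bullet> i) + c) has_derivative (\<lambda>v. m * (v \<bullet> i))) (at x)" for x
    by (auto intro!: derivative_eq_intros)
  have "(\<lambda>x. m * (x \<bullet> i) + c) differentiable_on UNIV"
    unfolding differentiable_on_def differentiable_def using D by blast
  moreover have "partial_deriv b (\<lambda>x. m * (x \<bullet> i) + c) = (\<lambda>x. m * (b \<bullet> i))" for b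
    using partial_deriv_eq[OF D] by (simp add: fun_eq_iff)
  ultimately have "C_k k (\<lambda>x. m * (x \<bullet> i) + c)" for k
    by (cases k) (auto intro: C_k_const differentiable_imp_continuous_on)
  then show ?thesis by (simp add: smooth_def)
qed

text \<open>The smooth function of interest is \<open>flat 1\<close>, that is, \<open>exp (- 1 / t)\<close> extended by zero to \<open>t \<le> 0\<close>; the
  polynomial factor makes the family closed under differentiation.\<close>

definition flat :: "real poly \<Rightarrow> real \<Rightarrow> real" where
  "flat p t = (if t > 0 then poly p (1 / t) * exp (- (1 / t)) else 0)"

lemma poly_times_exp_tendsto_0: "((\<lambda>u. poly p u * exp (- u)) \<longlongrightarrow> (0::real)) at_top"
proof -
  have "((\<lambda>u. \<Sum>i\<le>degree p. coeff p i * (u ^ i / exp u)) \<longlongrightarrow> (\<Sum>i\<le>degree p. coeff p i * 0)) at_top"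
    by (intro tendsto_intros tendsto_power_div_exp_0)
  moreover have "poly p u * exp (- u) = (\<Sum>i\<le>degree p. coeff p i * (u ^ i / exp u))" for u
    by (simp add: poly_altdef sum_distrib_right exp_minus divide_inverse mult.assoc)
  ultimately show ?thesis by simp
qed

lemma flat_tendsto_0: "(flat p \<longlongrightarrow> 0) (at 0)"
proof -
  have "((\<lambda>t. poly p (inverse t) * exp (- inverse t)) \<longlongrightarrow> 0) (at_right 0)"
    by (rule filterlim_compose[OF poly_times_exp_tendsto_0 filterlim_inverse_at_top_right])
  then have "(flat p \<longlongrightarrow> 0) (at_right 0)"
    by (rule filterlim_cong[THEN iffD1, rotated -1])
      (auto simp: flat_def eventually_at_filter inverse_eq_divide)
  moreover have "(flat p \<longlongrightarrow> 0) (at_left 0)"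
    by (rule filterlim_cong[THEN iffD1, rotated -1, OF tendsto_const])
      (auto simp: flat_def eventually_at_filter)
  ultimately show ?thesis by (simp add: filterlim_split_at)
qed

text \<open>The factor \<open>[:0, 0, 1:]\<close> comes from the derivative of \<open>1 / t\<close>.\<close>

lemma flat_has_derivative:
  "(flat p has_real_derivative flat ([:0, 0, 1:] * (p - pderiv p)) t) (at t)"
proof (cases t "0::real" rule: linorder_cases)
  case less
  have "((\<lambda>t. 0) has_real_derivative 0) (at t)" by simp
  then have "(flat p has_real_derivative 0) (at t)"
    by (rule has_field_derivative_transform_within_open[of _ _ _ "{..<0}"]) (use less in \<open>auto simp: flat_def\<close>)
  then show ?thesis using less by (simp add: flat_def)
next
  case equal
  have "((\<lambda>s. (flat p s - flat p 0) / (s - 0)) \<longlongrightarrow> 0) (at 0)"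
  proof (rule filterlim_cong[THEN iffD1, OF refl refl _ flat_tendsto_0[of "pCons 0 p"]])
    show "\<forall>\<^sub>F s in at 0. flat (pCons 0 p) s = (flat p s - flat p 0) / (s - 0)"
      by (rule always_eventually) (simp add: flat_def)
  qed
  then show ?thesis unfolding equal by (simp add: flat_def has_field_derivative_iff)
next
  case greater
  have inv: "((\<lambda>t. 1 / t) has_real_derivative - ((1 / t)\<^sup>2)) (at t)"
    using DERIV_inverse[of t] greater by (simp add: inverse_eq_divide power2_eq_square)
  have "((\<lambda>t. poly p (1 / t) * exp (- (1 / t))) has_real_derivative
      poly (pderiv p) (1 / t) * - ((1 / t)\<^sup>2) * exp (- (1 / t))
      + exp (- (1 / t)) * - (- ((1 / t)\<^sup>2)) * poly p (1 / t)) (at t)"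
    by (rule DERIV_mult[OF DERIV_chain2[OF poly_DERIV inv] DERIV_chain2[OF DERIV_exp DERIV_minus[OF inv]]])
  also have "poly (pderiv p) (1 / t) * - ((1 / t)\<^sup>2) * exp (- (1 / t))
      + exp (- (1 / t)) * - (- ((1 / t)\<^sup>2)) * poly p (1 / t)
     = flat ([:0, 0, 1:] * (p - pderiv p)) t"
    using greater by (simp add: flat_def algebra_simps power2_eq_square)
  finally have "((\<lambda>t. poly p (1 / t) * exp (- (1 / t))) has_real_derivative
     flat ([:0, 0, 1:] * (p - pderiv p)) t) (at t)" .
  then show ?thesis
    by (rule has_field_derivative_transform_within_open[of _ _ _ "{0<..}"]) (use greater in \<open>auto simp: flat_def\<close>)
qed

lemma smooth_flat: "smooth f \<Longrightarrow> smooth (\<lambda>x. flat p (f x))"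
  by (rule smooth_compose[of "range flat" "flat p" f]) (auto intro: flat_has_derivative)

definition box_bump :: "'a::euclidean_space \<Rightarrow> 'a \<Rightarrow> 'a \<Rightarrow> real" where
  "box_bump a b x = (\<Prod>i\<in>Basis. flat 1 (x \<bullet> i - a \<bullet> i) * flat 1 (b \<bullet> i - x \<bullet> i))"

lemma smooth_box_bump: "smooth (box_bump a b)"
proof -
  have "smooth (\<lambda>x. flat 1 (x \<bullet> i - a \<bullet> i) * flat 1 (b \<bullet> i - x \<bullet> i))" for i
    using smooth_affine[of 1 i "- (a \<bullet> i)"] smooth_affine[of "-1" i "b \<bullet> i"]
    by (intro smooth_mult smooth_flat) simp_all
  then show ?thesis unfolding box_bump_def[abs_def] by (intro smooth_prod)
qed

lemma flat_one_nonneg: "0 \<le> flat 1 t" and flat_one_pos_iff: "0 < flat 1 t \<longleftrightarrow> 0 < t"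
  by (auto simp: flat_def)

lemma box_bump_nonneg: "0 \<le> box_bump a b x"
  unfolding box_bump_def by (intro prod_nonneg mult_nonneg_nonneg flat_one_nonneg ballI)

lemma box_bump_pos_iff: "0 < box_bump a b x \<longleftrightarrow> x \<in> box a b"
proof
  assume "0 < box_bump a b x"
  then have nz: "\<forall>i\<in>Basis. flat 1 (x \<bullet> i - a \<bullet> i) * flat 1 (b \<bullet> i - x \<bullet> i) \<noteq> 0"
    unfolding box_bump_def using prod_zero[OF finite_Basis] by (metis (mono_tags, lifting) less_irrefl)
  have "flat 1 (x \<bullet> i - a \<bullet> i) > 0 \<and> flat 1 (b \<bullet> i - x \<bullet> i) > 0" if "i \<in> Basis" for i
    using nz[rule_format, OF that] flat_one_nonneg[of "x \<bullet> i - a \<bullet> i"] flat_one_nonneg[of "b \<bullet> i - x \<bullet> i"]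
    by auto
  then show "x \<in> box a b" by (auto simp: box_def flat_one_pos_iff)
next
  assume "x \<in> box a b"
  then show "0 < box_bump a b x"
    unfolding box_bump_def by (intro prod_pos) (auto simp: box_def flat_one_pos_iff)
qed

lemma test_functions_iff:
  "\<phi> \<in> test_functions \<Omega> \<longleftrightarrow>
    smooth \<phi> \<and> compact (closure {x. \<phi> x \<noteq> 0}) \<and> closure {x. \<phi> x \<noteq> 0} \<subseteq> \<Omega>"
  by (simp add: test_functions_def smooth_def)

lemma test_functionI:
  assumes "smooth \<phi>" "compact K" "K \<subseteq> \<Omega>" "\<And>x. \<phi> x \<noteq> 0 \<Longrightarrow> x \<in> K"
  shows "\<phi> \<in> test_functions \<Omega>"
proof -
  have "closure {x. \<phi> x \<noteq> 0} \<subseteq> K"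
    using assms by (intro closure_minimal) (auto intro: compact_imp_closed)
  moreover from this have "compact (closure {x. \<phi> x \<noteq> 0})"
    using compact_Int_closed[OF assms(2), of "closure {x. \<phi> x \<noteq> 0}"]
    by (simp add: Int_absorb1)
  ultimately show ?thesis using assms by (auto simp: test_functions_iff)
qed

text \<open>Cover the open set by countably many boxes whose closures lie in it, with bumps \<open>B\<^sub>j\<close>. Then
  \<open>1 - exp (- n (B\<^sub>0 + \<dots> + B\<^sub>n\<^sub>-\<^sub>1))\<close> vanishes off finitely many closed boxes and tends to one on the
  union.\<close>

lemma test_functions_tendsto_indicator:
  fixes U :: "'a::euclidean_space set"
  assumes "open U"
  obtains \<psi> where "\<And>n. \<psi> n \<in> test_functions U" "\<And>n x. 0 \<le> \<psi> n x \<and> \<psi> n x \<le> 1"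
    "\<And>x. (\<lambda>n. \<psi> n x) \<longlonglongrightarrow> indicator U x"
proof (cases "U = {}")
  case True
  show thesis
  proof (rule that[of "\<lambda>n x. 0"])
    show "(\<lambda>x. 0) \<in> test_functions U"
      by (rule test_functionI[of _ "{}"]) (auto intro: smooth_const)
  qed (simp_all add: True)
next
  case False
  define F where "F = {box a b |a b. cbox a b \<subseteq> U}"
  have UF: "\<Union>F = U"
  proof
    show "U \<subseteq> \<Union>F"
    proof
      fix x assume "x \<in> U"
      then obtain a b where "x \<in> box a b" "cbox a b \<subseteq> U"
        using open_contains_cbox[OF assms] by metis
      then show "x \<in> \<Union>F" by (auto simp: F_def)
    qed
    show "\<Union>F \<subseteq> U" using box_subset_cbox by (fastforce simp: F_def)
  qed
  obtain G where G: "G \<subseteq> F" "countable G" "\<Union>G = \<Union>F"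
    using Lindelof[of F] by (auto simp: F_def open_box)
  then have "G \<noteq> {}" using UF False by auto
  define e where "e = from_nat_into G"
  have e: "range e = G" unfolding e_def by (rule range_from_nat_into) fact+
  have "\<exists>a b. cbox a b \<subseteq> U \<and> e j = box a b" for j
  proof -
    have "e j \<in> F" using e G(1) by blast
    then show ?thesis by (auto simp: F_def)
  qed
  then obtain a b where ab: "\<And>j. cbox (a j) (b j) \<subseteq> U" "\<And>j. e j = box (a j) (b j)"
    by metis
  have cover: "\<exists>j. x \<in> box (a j) (b j)" if "x \<in> U" for x
  proof -
    have "x \<in> \<Union>(range e)" using that UF G(3) e by simp
    then show ?thesis using ab(2) by auto
  qed
  define S where "S n x = (\<Sum>j<n. box_bump (a j) (b j) x)" for n x
  define \<psi> where "\<psi> n x = 1 - exp (- real n * S n x)" for n x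
  have S0: "0 \<le> S n x" for n x unfolding S_def by (intro sum_nonneg box_bump_nonneg)
  have outside: "\<psi> n x = 0" if "x \<notin> (\<Union>j<n. cbox (a j) (b j))" for n x
  proof -
    have "box_bump (a j) (b j) x = 0" if "j < n" for j
    proof -
      have "x \<notin> box (a j) (b j)"
        using that \<open>x \<notin> _\<close> box_subset_cbox[of "a j" "b j"] by blast
      then have "\<not> 0 < box_bump (a j) (b j) x" by (simp only: box_bump_pos_iff not_False_eq_True)
      then show ?thesis using box_bump_nonneg[of "a j" "b j" x] by linarith
    qed
    then show ?thesis by (simp add: \<psi>_def S_def)
  qed
  show thesis
  proof (rule that[of \<psi>])
    fix n
    have "smooth (\<lambda>x. 1 + (-1) * exp (- real n * S n x))"
      unfolding S_def by (intro smooth_add smooth_const smooth_cmult smooth_exp smooth_sum smooth_box_bump)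
    then have "smooth (\<psi> n)" unfolding \<psi>_def[abs_def] by simp
    then show "\<psi> n \<in> test_functions U"
    proof (rule test_functionI)
      show "compact (\<Union>j<n. cbox (a j) (b j))" by (intro compact_UN) auto
      show "(\<Union>j<n. cbox (a j) (b j)) \<subseteq> U" using ab(1) by blast
      show "x \<in> (\<Union>j<n. cbox (a j) (b j))" if "\<psi> n x \<noteq> 0" for x
        using outside that by blast
    qed
    fix x
    show "0 \<le> \<psi> n x \<and> \<psi> n x \<le> 1" using S0[of n x] by (simp add: \<psi>_def)
  next
    fix x
    show "(\<lambda>n. \<psi> n x) \<longlonglongrightarrow> indicator U x"
    proof (cases "x \<in> U")
      case False
      then have "\<psi> n x = 0" for n using outside ab(1) by blast
      then show ?thesis using False by simp
    next
      case True
      then obtain j where "x \<in> box (a j) (b j)" using cover by blast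
      then have pos: "0 < box_bump (a j) (b j) x" by (simp only: box_bump_pos_iff)
      have "(\<lambda>n. exp (- real n * S n x)) \<longlonglongrightarrow> 0"
      proof (rule tendsto_sandwich[OF _ _ tendsto_const])
        show "\<forall>\<^sub>F n in sequentially. 0 \<le> exp (- real n * S n x)" by simp
        show "\<forall>\<^sub>F n in sequentially. exp (- real n * S n x) \<le> exp (- box_bump (a j) (b j) x) ^ n"
        proof (rule eventually_sequentiallyI[of "Suc j"])
          fix n assume "Suc j \<le> n"
          then have "box_bump (a j) (b j) x \<le> S n x"
            unfolding S_def by (intro member_le_sum box_bump_nonneg) auto
          then have "real n * box_bump (a j) (b j) x \<le> real n * S n x"
            by (rule mult_left_mono) simp
          then show "exp (- real n * S n x) \<le> exp (- box_bump (a j) (b j) x) ^ n"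
            by (simp add: exp_of_nat_mult[symmetric])
        qed
        show "(\<lambda>n. exp (- box_bump (a j) (b j) x) ^ n) \<longlonglongrightarrow> 0"
          by (rule LIMSEQ_power_zero) (use pos in simp)
      qed
      then have "(\<lambda>n. 1 - exp (- real n * S n x)) \<longlonglongrightarrow> 1 - 0"
        by (intro tendsto_diff tendsto_const)
      then show ?thesis using True by (simp add: \<psi>_def)
    qed
  qed
qed

lemma test_function_smooth: "\<phi> \<in> test_functions \<Omega> \<Longrightarrow> smooth \<phi>"
  by (simp add: test_functions_iff)

lemma test_function_outside: "\<phi> \<in> test_functions \<Omega> \<Longrightarrow> x \<notin> \<Omega> \<Longrightarrow> \<phi> x = 0"
  using closure_subset[of "{x. \<phi> x \<noteq> 0}"] by (auto simp: test_functions_iff)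

lemma test_function_mult:
  assumes "smooth f" "\<phi> \<in> test_functions \<Omega>"
  shows "(\<lambda>x. f x * \<phi> x) \<in> test_functions \<Omega>"
  by (rule test_functionI[of _ "closure {x. \<phi> x \<noteq> 0}"])
    (use assms closure_subset[of "{x. \<phi> x \<noteq> 0}"] in \<open>auto simp: test_functions_iff intro: smooth_mult\<close>)

lemma test_function_cmult: "\<phi> \<in> test_functions \<Omega> \<Longrightarrow> (\<lambda>x. c * \<phi> x) \<in> test_functions \<Omega>"
  by (rule test_function_mult[OF smooth_const])

lemma test_function_zero: "(\<lambda>x. 0) \<in> test_functions \<Omega>"
  by (rule test_functionI[of _ "{}"]) (auto intro: smooth_const)

lemma test_function_add:
  assumes \<phi>: "\<phi> \<in> test_functions \<Omega>" and \<psi>: "\<psi> \<in> test_functions \<Omega>"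
  shows "(\<lambda>x. \<phi> x + \<psi> x) \<in> test_functions \<Omega>"
proof (rule test_functionI)
  show "smooth (\<lambda>x. \<phi> x + \<psi> x)" using assms by (intro smooth_add test_function_smooth)
  show "compact (closure {x. \<phi> x \<noteq> 0} \<union> closure {x. \<psi> x \<noteq> 0})"
    "closure {x. \<phi> x \<noteq> 0} \<union> closure {x. \<psi> x \<noteq> 0} \<subseteq> \<Omega>"
    using assms by (auto simp: test_functions_iff)
  show "x \<in> closure {x. \<phi> x \<noteq> 0} \<union> closure {x. \<psi> x \<noteq> 0}" if "\<phi> x + \<psi> x \<noteq> 0" for x
    using that closure_subset[of "{x. \<phi> x \<noteq> 0}"] closure_subset[of "{x. \<psi> x \<noteq> 0}"]
    by (cases "\<phi> x = 0") auto
qed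

lemma test_function_sum:
  "(\<And>i. i \<in> I \<Longrightarrow> \<phi> i \<in> test_functions \<Omega>) \<Longrightarrow> (\<lambda>x. \<Sum>i\<in>I. \<phi> i x) \<in> test_functions \<Omega>"
  by (induction I rule: infinite_finite_induct) (auto intro: test_function_zero test_function_add)

lemma test_function_partial_deriv:
  assumes "\<phi> \<in> test_functions \<Omega>" "b \<in> Basis"
  shows "partial_deriv b \<phi> \<in> test_functions \<Omega>"
  by (rule test_functionI[of _ "closure {x. \<phi> x \<noteq> 0}"])
    (use assms partial_deriv_support[of b \<phi>] in \<open>auto simp: test_functions_iff intro: smooth_partial_deriv\<close>)

lemma partial_derivs_Nil [simp]: "partial_derivs [] f = f"
  and partial_derivs_Cons [simp]: "partial_derivs (b # bs) f = partial_deriv b (partial_derivs bs f)"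
  by (simp_all add: partial_derivs_def)

lemma test_function_partial_derivs:
  "\<phi> \<in> test_functions \<Omega> \<Longrightarrow> set bs \<subseteq> Basis \<Longrightarrow> partial_derivs bs \<phi> \<in> test_functions \<Omega>"
  by (induction bs) (auto intro: test_function_partial_deriv)

lemma test_function_laplacian: "\<phi> \<in> test_functions \<Omega> \<Longrightarrow> laplacian \<phi> \<in> test_functions \<Omega>"
  unfolding laplacian_def[abs_def] by (intro test_function_sum test_function_partial_derivs) auto

lemma smooth_partial_derivs: "smooth f \<Longrightarrow> set bs \<subseteq> Basis \<Longrightarrow> smooth (partial_derivs bs f)"
  by (induction bs) (auto intro: smooth_partial_deriv)

lemma partial_derivs_add:
  assumes "smooth f" "smooth g" "set bs \<subseteq> Basis"
  shows "partial_derivs bs (\<lambda>x. f x + g x) = (\<lambda>x. partial_derivs bs f x + partial_derivs bs g x)"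
  using assms
proof (induction bs)
  case (Cons b bs)
  then have "smooth (partial_derivs bs f)" "smooth (partial_derivs bs g)"
    by (auto intro: smooth_partial_derivs)
  with Cons show ?case by (simp add: partial_deriv_add smooth_differentiable)
qed simp

lemma partial_derivs_cmult:
  assumes "smooth f" "set bs \<subseteq> Basis"
  shows "partial_derivs bs (\<lambda>x. c * f x) = (\<lambda>x. c * partial_derivs bs f x)"
  using assms
proof (induction bs)
  case (Cons b bs)
  then have "smooth (partial_derivs bs f)" by (auto intro: smooth_partial_derivs)
  with Cons show ?case by (simp add: partial_deriv_cmult smooth_differentiable)
qed simp

lemma smooth_partial_deriv_commute:
  assumes "smooth f" "b \<in> Basis" "c \<in> Basis"
  shows "partial_deriv b (partial_deriv c f) = partial_deriv c (partial_deriv b f)"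
  using assms partial_deriv_commute unfolding smooth_def by blast

lemma directions2_cases:
  assumes "bs \<in> directions2"
  obtains "bs = []" | i where "i \<in> Basis" "bs = [i]" | i j where "i \<in> Basis" "j \<in> Basis" "bs = [i, j]"
proof (cases bs)
  case Nil
  then show thesis by (rule that(1))
next
  case (Cons i cs)
  show thesis
  proof (cases cs)
    case Nil
    then show thesis using that(2)[of i] Cons assms by (simp add: directions2_def)
  next
    case (Cons j ds)
    then show thesis using that(3)[of i j] \<open>bs = i # cs\<close> assms by (simp add: directions2_def)
  qed
qed

section \<open>The a priori estimate on a bounded open set\<close>

locale bounded_open =
  fixes \<Omega> :: "'a::euclidean_space set"
  assumes open_domain: "open \<Omega>" and bounded_domain: "bounded \<Omega>"
begin

abbreviation "M \<equiv> lebesgue_on \<Omega>"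

lemma domain_sets [simp]: "\<Omega> \<in> sets lebesgue"
  using open_domain by simp

sublocale finite_measure M
  using open_domain bounded_domain by (intro finite_measure_lebesgue_on lmeasurable_open)

lemma continuous_measurable: "continuous_on UNIV f \<Longrightarrow> f \<in> borel_measurable M"
  by (intro measurable_restrict_space1 measurable_completion)
    (simp add: borel_measurable_continuous_onI)

lemma test_measurable: "\<phi> \<in> test_functions \<Omega> \<Longrightarrow> \<phi> \<in> borel_measurable M"
  by (intro continuous_measurable smooth_continuous test_function_smooth)

lemma integrable_test:
  assumes \<phi>: "\<phi> \<in> test_functions \<Omega>" shows "integrable M \<phi>"
    and integral_test: "(LINT x|M. \<phi> x) = (LINT x|lborel. \<phi> x)"
proof -
  have cont: "continuous_on UNIV \<phi>" by (intro smooth_continuous test_function_smooth[OF \<phi>])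
  have eq: "(\<lambda>x. indicator \<Omega> x * \<phi> x) = \<phi>"
    using test_function_outside[OF \<phi>] by (auto simp: indicator_def fun_eq_iff)
  have meas: "\<phi> \<in> borel_measurable lborel" by (simp add: borel_measurable_continuous_onI[OF cont])
  have "integrable lborel \<phi>"
    using \<phi> by (intro integrable_compact_support cont) (simp add: test_functions_iff)
  then show "integrable M \<phi>"
    by (simp add: integrable_restrict_space eq integrable_completion[OF meas])
  show "(LINT x|M. \<phi> x) = (LINT x|lborel. \<phi> x)"
    by (simp add: integral_restrict_space eq integral_completion[OF meas])
qed

lemma square_integrable_test:
  assumes "\<phi> \<in> test_functions \<Omega>" shows "square_integrable M \<phi>"
  using integrable_test(1)[OF test_function_mult[OF test_function_smooth[OF assms] assms]]
    test_measurable[OF assms]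
  by (simp add: square_integrable_def power2_eq_square)

lemma integration_by_parts:
  assumes f: "smooth f" and \<psi>: "\<psi> \<in> test_functions \<Omega>" and b: "b \<in> Basis"
  shows "(LINT x|M. f x * partial_deriv b \<psi> x) = - (LINT x|M. partial_deriv b f x * \<psi> x)"
proof -
  have t: "(\<lambda>x. f x * \<psi> x) \<in> test_functions \<Omega>" by (rule test_function_mult[OF f \<psi>])
  have eq: "partial_deriv b (\<lambda>x. f x * \<psi> x) = (\<lambda>x. partial_deriv b f x * \<psi> x + f x * partial_deriv b \<psi> x)"
    by (intro partial_deriv_mult smooth_differentiable f test_function_smooth[OF \<psi>])
  have "0 = (LINT x|M. partial_deriv b (\<lambda>x. f x * \<psi> x) x)"
    unfolding integral_test[OF test_function_partial_deriv[OF t b]]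
    using t by (intro integral_partial_deriv_eq_0[symmetric] smooth_differentiable smooth_continuous
        smooth_partial_deriv b) (auto simp: test_functions_iff)
  also have "\<dots> = (LINT x|M. partial_deriv b f x * \<psi> x) + (LINT x|M. f x * partial_deriv b \<psi> x)"
    unfolding eq by (intro Bochner_Integration.integral_add integrable_test(1) test_function_mult
        smooth_partial_deriv f b \<psi> test_function_partial_deriv)
  finally show ?thesis by simp
qed

lemma domain_radius: obtains R where "R \<ge> 0" "\<And>x. x \<in> \<Omega> \<Longrightarrow> norm x \<le> R"
  using bounded_domain unfolding bounded_pos by (meson less_imp_le)

text \<open>Integrate \<open>\<phi>\<^sup>2 = \<phi>\<^sup>2 \<partial>\<^sub>b (x \<bullet> b)\<close> by parts and apply the Cauchy-Schwarz inequality to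
  \<open>2 \<phi> (x \<bullet> b) \<partial>\<^sub>b \<phi>\<close>.\<close>

lemma Poincare:
  assumes \<phi>: "\<phi> \<in> test_functions \<Omega>" and b: "b \<in> Basis"
    and R0: "R \<ge> 0" and R: "\<And>x. x \<in> \<Omega> \<Longrightarrow> norm x \<le> R"
  shows "l2norm M \<phi> \<le> 2 * R * l2norm M (partial_deriv b \<phi>)"
proof -
  let ?x = "\<lambda>x::'a. x \<bullet> b" and ?d = "partial_deriv b \<phi>"
  have sx: "smooth ?x" using smooth_affine[of 1 b 0] by simp
  have dx: "partial_deriv b ?x = (\<lambda>x. 1)"
  proof
    fix x :: 'a
    have "(?x has_derivative ?x) (at x)" by (auto intro!: derivative_eq_intros)
    from partial_deriv_eq[OF this] show "partial_deriv b ?x x = 1" using b by simp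
  qed
  have \<phi>\<phi>: "(\<lambda>x. \<phi> x * \<phi> x) \<in> test_functions \<Omega>" by (rule test_function_mult[OF test_function_smooth[OF \<phi>] \<phi>])
  have d: "?d \<in> test_functions \<Omega>" by (rule test_function_partial_deriv[OF \<phi> b])
  have sq: "square_integrable M \<phi>" "square_integrable M (\<lambda>x. ?x x * ?d x)" "square_integrable M ?d"
    by (intro square_integrable_test test_function_mult sx \<phi> d)+
  have dsq: "partial_deriv b (\<lambda>x. \<phi> x * \<phi> x) = (\<lambda>x. ?d x * \<phi> x + \<phi> x * ?d x)"
    by (intro partial_deriv_mult smooth_differentiable test_function_smooth[OF \<phi>])
  have "(LINT x|M. ?x x * (?d x * \<phi> x + \<phi> x * ?d x)) = - (LINT x|M. 1 * (\<phi> x * \<phi> x))"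
    using integration_by_parts[OF sx \<phi>\<phi> b] unfolding dx dsq .
  moreover have "(\<lambda>x. ?x x * (?d x * \<phi> x + \<phi> x * ?d x)) = (\<lambda>x. 2 * (\<phi> x * (?x x * ?d x)))"
    by (simp add: fun_eq_iff)
  ultimately have "(l2norm M \<phi>)\<^sup>2 = - 2 * (LINT x|M. \<phi> x * (?x x * ?d x))"
    unfolding l2norm_power2 by (simp add: power2_eq_square)
  also have "\<dots> \<le> 2 * (l2norm M \<phi> * l2norm M (\<lambda>x. ?x x * ?d x))"
    using Cauchy_Schwarz_integral[OF sq(1,2)] by linarith
  also have "\<dots> \<le> 2 * (l2norm M \<phi> * (R * l2norm M ?d))"
  proof -
    have "l2norm M (\<lambda>x. ?x x * ?d x) \<le> l2norm M (\<lambda>x. R * ?d x)"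
    proof (rule l2norm_mono[OF sq(2) square_integrable_cmult[OF sq(3)]], rule AE_I2)
      fix x assume "x \<in> space M"
      then have x: "x \<in> \<Omega>" by simp
      then have "\<bar>?x x\<bar> \<le> \<bar>R\<bar>" using R[OF x] Basis_le_norm[OF b, of x] by linarith
      then show "\<bar>?x x * ?d x\<bar> \<le> \<bar>R * ?d x\<bar>" unfolding abs_mult by (rule mult_right_mono) simp
    qed
    then show ?thesis using R0 by (intro mult_left_mono) (simp_all add: l2norm_cmult)
  qed
  finally have "l2norm M \<phi> * l2norm M \<phi> \<le> l2norm M \<phi> * (2 * R * l2norm M ?d)"
    by (simp add: power2_eq_square algebra_simps)
  show ?thesis
  proof (cases "l2norm M \<phi> = 0")
    case False
    then have "0 < l2norm M \<phi>" using l2norm_nonneg[of M \<phi>] by linarith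
    then show ?thesis using \<open>_ \<le> l2norm M \<phi> * (2 * R * l2norm M ?d)\<close> by simp
  next
    case True
    then show ?thesis using R0 by simp
  qed
qed

text \<open>One \<open>j\<close> and one \<open>i\<close> change sides by two integrations by parts, whose signs cancel.\<close>

lemma integral_second_derivs:
  assumes \<phi>: "\<phi> \<in> test_functions \<Omega>" and i: "i \<in> Basis" and j: "j \<in> Basis"
  shows "(LINT x|M. partial_derivs [i, i] \<phi> x * partial_derivs [j, j] \<phi> x)
    = (l2norm M (partial_derivs [i, j] \<phi>))\<^sup>2"
proof -
  note s = test_function_smooth[OF \<phi>]
  let ?g = "partial_deriv j (partial_deriv i \<phi>)"
  have sg: "smooth ?g" by (intro smooth_partial_deriv s i j)
  have tj: "partial_deriv j \<phi> \<in> test_functions \<Omega>" by (rule test_function_partial_deriv[OF \<phi> j])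
  have "(LINT x|M. partial_deriv i (partial_deriv i \<phi>) x * partial_deriv j (partial_deriv j \<phi>) x)
    = - (LINT x|M. partial_deriv j (partial_deriv i (partial_deriv i \<phi>)) x * partial_deriv j \<phi> x)"
    by (intro integration_by_parts smooth_partial_deriv s i j tj)
  also have "partial_deriv j (partial_deriv i (partial_deriv i \<phi>)) = partial_deriv i ?g"
    by (intro smooth_partial_deriv_commute smooth_partial_deriv s i j)
  also have "- (LINT x|M. partial_deriv i ?g x * partial_deriv j \<phi> x)
    = (LINT x|M. ?g x * partial_deriv i (partial_deriv j \<phi>) x)"
    using integration_by_parts[OF sg tj i] by simp
  also have "?g = partial_deriv i (partial_deriv j \<phi>)"
    by (intro smooth_partial_deriv_commute s i j)
  finally show ?thesis unfolding l2norm_power2 by (simp add: power2_eq_square)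
qed

lemma l2norm_laplacian:
  assumes \<phi>: "\<phi> \<in> test_functions \<Omega>"
  shows "(l2norm M (laplacian \<phi>))\<^sup>2 = (\<Sum>i\<in>Basis. \<Sum>j\<in>Basis. (l2norm M (partial_derivs [i, j] \<phi>))\<^sup>2)"
proof -
  have int: "integrable M (\<lambda>x. partial_derivs [i, i] \<phi> x * partial_derivs [j, j] \<phi> x)"
    if "i \<in> Basis" "j \<in> Basis" for i j
    by (intro integrable_product square_integrable_test test_function_partial_derivs \<phi>) (use that in auto)
  have "(l2norm M (laplacian \<phi>))\<^sup>2
      = (LINT x|M. (\<Sum>i\<in>Basis. \<Sum>j\<in>Basis. partial_derivs [i, i] \<phi> x * partial_derivs [j, j] \<phi> x))"
    unfolding l2norm_power2 by (simp only: laplacian_def power2_eq_square sum_product)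
  also have "\<dots> = (\<Sum>i\<in>Basis. \<Sum>j\<in>Basis. (LINT x|M. partial_derivs [i, i] \<phi> x * partial_derivs [j, j] \<phi> x))"
    using int by (simp add: Bochner_Integration.integral_sum del: partial_derivs_Cons)
  also have "\<dots> = (\<Sum>i\<in>Basis. \<Sum>j\<in>Basis. (l2norm M (partial_derivs [i, j] \<phi>))\<^sup>2)"
    by (intro sum.cong refl integral_second_derivs \<phi>)
  finally show ?thesis .
qed

lemma l2norm_second_deriv_le_laplacian:
  assumes \<phi>: "\<phi> \<in> test_functions \<Omega>" and i: "i \<in> Basis" and j: "j \<in> Basis"
  shows "l2norm M (partial_derivs [i, j] \<phi>) \<le> l2norm M (laplacian \<phi>)"
proof (rule power2_le_imp_le)
  have "(l2norm M (partial_derivs [i, j] \<phi>))\<^sup>2 \<le> (\<Sum>j\<in>Basis. (l2norm M (partial_derivs [i, j] \<phi>))\<^sup>2)"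
    by (rule member_le_sum[OF j]) auto
  also have "\<dots> \<le> (\<Sum>i\<in>Basis. \<Sum>j\<in>Basis. (l2norm M (partial_derivs [i, j] \<phi>))\<^sup>2)"
    by (rule member_le_sum[OF i]) (auto intro: sum_nonneg)
  finally show "(l2norm M (partial_derivs [i, j] \<phi>))\<^sup>2 \<le> (l2norm M (laplacian \<phi>))\<^sup>2"
    by (simp only: l2norm_laplacian[OF \<phi>])
qed simp

text \<open>On test functions the Laplacian alone controls the full \<open>H2\<close> norm: second derivatives by the
  preceding identity, lower ones by the Poincare inequality. This is the a priori estimate behind the
  isomorphism.\<close>

lemma laplacian_bounds_derivs:
  "\<exists>K\<ge>0. \<forall>bs\<in>directions2. \<forall>\<phi>\<in>test_functions \<Omega>.
    l2norm M (partial_derivs bs \<phi>) \<le> K * l2norm M (laplacian \<phi>)"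
proof -
  obtain R where R: "R \<ge> 0" "\<And>x. x \<in> \<Omega> \<Longrightarrow> norm x \<le> R" using domain_radius by blast
  define K where "K = 1 + 2 * R + 2 * R * (2 * R)"
  have K: "1 \<le> K" "2 * R \<le> K" "2 * R * (2 * R) \<le> K" using R(1) by (auto simp: K_def)
  have "l2norm M (partial_derivs bs \<phi>) \<le> K * l2norm M (laplacian \<phi>)"
    if bs: "bs \<in> directions2" and \<phi>: "\<phi> \<in> test_functions \<Omega>" for bs \<phi>
  proof -
    let ?L = "l2norm M (laplacian \<phi>)"
    have first: "l2norm M (partial_deriv i \<phi>) \<le> 2 * R * ?L" if i: "i \<in> Basis" for i
      using Poincare[OF test_function_partial_deriv[OF \<phi> i] i R]
        mult_left_mono[OF l2norm_second_deriv_le_laplacian[OF \<phi> i i], of "2 * R"] R(1) by simp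
    have scale: "c * ?L \<le> K * ?L" if "c \<le> K" for c using that by (intro mult_right_mono) auto
    from bs show ?thesis
    proof (cases rule: directions2_cases)
      case 1
      obtain i :: 'a where i: "i \<in> Basis" using nonempty_Basis by blast
      have "l2norm M \<phi> \<le> 2 * R * (2 * R * ?L)"
        using Poincare[OF \<phi> i R] mult_left_mono[OF first[OF i], of "2 * R"] R(1) by simp
      with scale[OF K(3)] show ?thesis by (simp add: \<open>bs = []\<close> mult.assoc)
    next
      case (2 i)
      with first[of i] scale[OF K(2)] show ?thesis by simp
    next
      case (3 i j)
      with l2norm_second_deriv_le_laplacian[OF \<phi>, of i j] scale[OF K(1)] show ?thesis
        unfolding 3(3) by linarith
    qed
  qed
  moreover have "K \<ge> 0" using K by simp
  ultimately show ?thesis by blast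
qed

end

section \<open>The fundamental lemma of the calculus of variations\<close>

context bounded_open
begin

lemma integral_open_eq_0:
  assumes h: "square_integrable M h" and orth: "\<And>\<phi>. \<phi> \<in> test_functions \<Omega> \<Longrightarrow> (LINT x|M. h x * \<phi> x) = 0"
    and U: "open U" "U \<subseteq> \<Omega>"
  shows "(LINT x|M. h x * indicator U x) = 0"
proof -
  obtain \<psi> where \<psi>: "\<And>n. \<psi> n \<in> test_functions U" "\<And>n x. 0 \<le> \<psi> n x \<and> \<psi> n x \<le> 1"
    "\<And>x. (\<lambda>n. \<psi> n x) \<longlonglongrightarrow> indicator U x"
    using test_functions_tendsto_indicator[OF U(1)] by blast
  have test: "\<psi> n \<in> test_functions \<Omega>" for n
    using \<psi>(1)[of n] U(2) by (auto simp: test_functions_iff)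
  have hm: "h \<in> borel_measurable M" using h by (simp add: square_integrable_def)
  have hi: "integrable M h" using integrable_product[OF h square_integrable_const[of 1]] by simp
  have "U \<in> sets M" using U by (simp add: sets_restrict_space_iff)
  then have im: "(indicator U :: 'a \<Rightarrow> real) \<in> borel_measurable M" by simp
  have "(\<lambda>n. LINT x|M. h x * \<psi> n x) \<longlonglongrightarrow> (LINT x|M. h x * indicator U x)"
  proof (rule integral_dominated_convergence[where w = "\<lambda>x. \<bar>h x\<bar>"])
    show "(\<lambda>x. h x * indicator U x) \<in> borel_measurable M" using hm im by simp
    show "(\<lambda>x. h x * \<psi> n x) \<in> borel_measurable M" for n using hm test_measurable[OF test] by simp
    show "integrable M (\<lambda>x. \<bar>h x\<bar>)" using hi by simp
    show "AE x in M. (\<lambda>n. h x * \<psi> n x) \<longlonglongrightarrow> h x * indicator U x"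
      by (intro AE_I2 tendsto_mult_left \<psi>(3))
    show "AE x in M. norm (h x * \<psi> n x) \<le> \<bar>h x\<bar>" for n
      using \<psi>(2)[of n] by (intro AE_I2) (simp add: abs_mult mult_left_le)
  qed
  then show ?thesis using orth[OF test] by (simp add: LIMSEQ_const_iff)
qed

text \<open>Up to a null set \<open>{h > 0}\<close> is a countable intersection of open sets, over each of which \<open>h\<close>
  integrates to zero.\<close>

lemma AE_nonpos_of_orthogonal:
  assumes h: "square_integrable M h" and orth: "\<And>\<phi>. \<phi> \<in> test_functions \<Omega> \<Longrightarrow> (LINT x|M. h x * \<phi> x) = 0"
  shows "AE x in M. h x \<le> 0"
proof -
  have hm: "h \<in> borel_measurable M" using h by (simp add: square_integrable_def)
  have hi: "integrable M h" using integrable_product[OF h square_integrable_const[of 1]] by simp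
  define A where "A = {x \<in> \<Omega>. h x > 0}"
  have "{x \<in> space M. h x > 0} \<in> sets M" using hm by measurable
  then have AM: "A \<in> sets M" by (simp add: A_def)
  then have "A \<in> sets lebesgue" by (simp add: sets_restrict_space_iff)
  then obtain C T where CT: "gdelta C" "T \<in> null_sets lebesgue" "A \<union> T = C"
    using lebesgue_set_almost_gdelta by metis
  from CT(1) obtain F :: "nat \<Rightarrow> 'a set" where F: "\<And>n. open (F n)" "C = (\<Inter>n. F n)"
    by (auto elim: gdelta.cases)
  define U where "U n = (\<Inter>k\<le>n. F k) \<inter> \<Omega>" for n
  have U: "open (U n)" "U n \<subseteq> \<Omega>" for n
    using F(1) open_domain by (auto simp: U_def)
  have UM: "(indicator (U n) :: 'a \<Rightarrow> real) \<in> borel_measurable M" for n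
    using U[of n] by (intro borel_measurable_indicator) (simp add: sets_restrict_space_iff)
  have lim: "(\<lambda>n. indicator (U n) x :: real) \<longlonglongrightarrow> indicator C x" if x: "x \<in> \<Omega>" for x
  proof (cases "x \<in> C")
    case True
    then have "x \<in> U n" for n using x F(2) by (auto simp: U_def)
    then show ?thesis using True by simp
  next
    case False
    then obtain m where "x \<notin> F m" using F(2) by auto
    then have "\<forall>\<^sub>F n in sequentially. indicator (U n) x = (0::real)"
      by (intro eventually_sequentiallyI[of m]) (auto simp: U_def indicator_def)
    then show ?thesis using False by (simp add: tendsto_eventually)
  qed
  have AT: "AE x in M. x \<notin> T"
  proof -
    have "AE x in lebesgue. x \<notin> T" by (rule AE_not_in[OF CT(2)])
    then show ?thesis by (subst AE_restrict_space_iff) auto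
  qed
  have "(\<lambda>n. LINT x|M. h x * indicator (U n) x) \<longlonglongrightarrow> (LINT x|M. h x * indicator A x)"
  proof (rule integral_dominated_convergence[where w = "\<lambda>x. \<bar>h x\<bar>"])
    show "(\<lambda>x. h x * indicator A x) \<in> borel_measurable M" using hm AM by simp
    show "(\<lambda>x. h x * indicator (U n) x) \<in> borel_measurable M" for n using hm UM by simp
    show "integrable M (\<lambda>x. \<bar>h x\<bar>)" using hi by simp
    show "AE x in M. (\<lambda>n. h x * indicator (U n) x) \<longlonglongrightarrow> h x * indicator A x"
      using AT AE_space
    proof eventually_elim
      case (elim x)
      then have "(indicator C x :: real) = indicator A x" using CT(3) by (auto simp: indicator_def)
      then show ?case using tendsto_mult_left[OF lim[of x], of "h x"] elim by simp
    qed
    show "AE x in M. norm (h x * indicator (U n) x) \<le> \<bar>h x\<bar>" for n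
      by (intro AE_I2) (simp add: indicator_def)
  qed
  then have "(LINT x|M. h x * indicator A x) = 0"
    using integral_open_eq_0[OF h orth U] by (simp add: LIMSEQ_const_iff)
  moreover have "integrable M (\<lambda>x. h x * indicator A x)"
    using integrable_mult_indicator[OF AM hi] by (simp add: mult.commute)
  ultimately have "AE x in M. h x * indicator A x = 0"
    by (subst (asm) integral_nonneg_eq_0_iff_AE) (auto simp: A_def indicator_def)
  then show ?thesis using AE_space
    by eventually_elim (auto simp: A_def indicator_def split: if_splits)
qed

lemma AE_zero_of_orthogonal:
  assumes h: "square_integrable M h" and orth: "\<And>\<phi>. \<phi> \<in> test_functions \<Omega> \<Longrightarrow> (LINT x|M. h x * \<phi> x) = 0"
  shows "AE x in M. h x = 0"
proof -
  have "AE x in M. h x \<le> 0" by (rule AE_nonpos_of_orthogonal[OF h orth])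
  moreover have "AE x in M. - h x \<le> 0"
    by (rule AE_nonpos_of_orthogonal) (use square_integrable_cmult[OF h, of "-1"] orth in simp_all)
  ultimately show ?thesis by eventually_elim simp
qed

end

section \<open>Classes of square-integrable functions\<close>

lemma finite_directions2: "finite (directions2 :: 'a::euclidean_space list set)"
  unfolding directions2_def by (rule finite_lists_length_le[OF finite_Basis])

lemma directions2_Basis: "bs \<in> directions2 \<Longrightarrow> set bs \<subseteq> Basis"
  by (simp add: directions2_def)

lemma Nil_directions2: "[] \<in> directions2"
  by (simp add: directions2_def)

lemma pair_directions2: "b \<in> Basis \<Longrightarrow> [b, b] \<in> directions2"
  by (simp add: directions2_def)

lemma ae_class_cong:
  assumes "AE x in lebesgue_on \<Omega>. f x = g x"
  shows "ae_class \<Omega> f = ae_class \<Omega> g"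
proof -
  have "(AE x in lebesgue_on \<Omega>. h x = f x) \<longleftrightarrow> (AE x in lebesgue_on \<Omega>. h x = g x)" for h
  proof
    assume "AE x in lebesgue_on \<Omega>. h x = f x"
    with assms show "AE x in lebesgue_on \<Omega>. h x = g x" by eventually_elim simp
  next
    assume "AE x in lebesgue_on \<Omega>. h x = g x"
    with assms show "AE x in lebesgue_on \<Omega>. h x = f x" by eventually_elim simp
  qed
  then show ?thesis by (simp add: ae_class_def)
qed

lemma rep_in: "U \<noteq> {} \<Longrightarrow> rep U \<in> U"
  by (simp add: rep_def some_in_eq)

lemma rep_ae_class:
  assumes "f \<in> borel_measurable (lebesgue_on \<Omega>)"
  shows "rep (ae_class \<Omega> f) \<in> borel_measurable (lebesgue_on \<Omega>)"
    and "AE x in lebesgue_on \<Omega>. rep (ae_class \<Omega> f) x = f x"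
proof -
  have "f \<in> ae_class \<Omega> f" using assms by (simp add: ae_class_def)
  then have "rep (ae_class \<Omega> f) \<in> ae_class \<Omega> f" by (intro rep_in) auto
  then show "rep (ae_class \<Omega> f) \<in> borel_measurable (lebesgue_on \<Omega>)"
    "AE x in lebesgue_on \<Omega>. rep (ae_class \<Omega> f) x = f x"
    by (auto simp: ae_class_def)
qed

lemma L2_norm_eq: "L2_norm \<Omega> U = l2norm (lebesgue_on \<Omega>) (rep U)"
  by (simp add: L2_norm_def L2_inner_def l2norm_def power2_eq_square)

lemma L2_norm_ae_class:
  "f \<in> borel_measurable (lebesgue_on \<Omega>) \<Longrightarrow> L2_norm \<Omega> (ae_class \<Omega> f) = l2norm (lebesgue_on \<Omega>) f"
  unfolding L2_norm_eq by (intro l2norm_cong_AE rep_ae_class)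

lemma ae_class_in_L2: "square_integrable (lebesgue_on \<Omega>) f \<Longrightarrow> ae_class \<Omega> f \<in> L2 \<Omega>"
  by (auto simp: L2_def square_integrable_def)

lemma square_integrable_rep_ae_class:
  assumes "square_integrable (lebesgue_on \<Omega>) f"
  shows "square_integrable (lebesgue_on \<Omega>) (rep (ae_class \<Omega> f))"
proof (rule square_integrable_cong_AE[OF assms])
  note m = square_integrable_measurable[OF assms]
  show "rep (ae_class \<Omega> f) \<in> borel_measurable (lebesgue_on \<Omega>)" by (rule rep_ae_class(1)[OF m])
  show "AE x in lebesgue_on \<Omega>. f x = rep (ae_class \<Omega> f) x" using rep_ae_class(2)[OF m] by eventually_elim simp
qed

lemma L2_cases:
  assumes "U \<in> L2 \<Omega>"
  shows "square_integrable (lebesgue_on \<Omega>) (rep U)" and "ae_class \<Omega> (rep U) = U"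
proof -
  obtain f where f: "square_integrable (lebesgue_on \<Omega>) f" "U = ae_class \<Omega> f"
    using assms by (auto simp: L2_def square_integrable_def)
  show "square_integrable (lebesgue_on \<Omega>) (rep U)"
    using square_integrable_rep_ae_class[OF f(1)] f(2) by simp
  show "ae_class \<Omega> (rep U) = U"
    using ae_class_cong[OF rep_ae_class(2)[OF square_integrable_measurable[OF f(1)]]] f(2) by simp
qed

lemma integral_rep_ae_class:
  assumes "f \<in> borel_measurable (lebesgue_on \<Omega>)" "g \<in> borel_measurable (lebesgue_on \<Omega>)"
  shows "(LINT x|lebesgue_on \<Omega>. rep (ae_class \<Omega> f) x * g x) = (LINT x|lebesgue_on \<Omega>. f x * g x)"
proof (rule integral_cong_AE)
  show "AE x in lebesgue_on \<Omega>. rep (ae_class \<Omega> f) x * g x = f x * g x"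
    using rep_ae_class(2)[OF assms(1)] by eventually_elim simp
qed (use assms rep_ae_class(1)[OF assms(1)] in auto)

lemma L2_norm_class_diff:
  assumes "square_integrable (lebesgue_on \<Omega>) f" "square_integrable (lebesgue_on \<Omega>) g"
  shows "L2_norm \<Omega> (class_diff \<Omega> (ae_class \<Omega> f) (ae_class \<Omega> g)) = l2norm (lebesgue_on \<Omega>) (\<lambda>x. f x - g x)"
proof -
  note m = assms[THEN square_integrable_measurable]
  have "class_diff \<Omega> (ae_class \<Omega> f) (ae_class \<Omega> g) = ae_class \<Omega> (\<lambda>x. f x - g x)"
    unfolding class_diff_def
    by (rule ae_class_cong) (use rep_ae_class(2)[OF m(1)] rep_ae_class(2)[OF m(2)] in \<open>eventually_elim, simp\<close>)
  then show ?thesis using m by (simp add: L2_norm_ae_class)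
qed

text \<open>The axioms of \<^locale>\<open>Metric_space\<close> demand symmetry of the distance for all arguments, also for sets
  that are not classes of measurable functions. The class of a function that agrees almost everywhere
  with no measurable one is empty, and so is the class of its negative.\<close>

lemma ae_class_minus_cases:
  obtains "ae_class \<Omega> f = {}" "ae_class \<Omega> (\<lambda>x. - f x) = {}"
  | g where "g \<in> borel_measurable (lebesgue_on \<Omega>)"
    "ae_class \<Omega> f = ae_class \<Omega> g" "ae_class \<Omega> (\<lambda>x. - f x) = ae_class \<Omega> (\<lambda>x. - g x)"
proof (cases "\<exists>g \<in> borel_measurable (lebesgue_on \<Omega>). AE x in lebesgue_on \<Omega>. f x = g x")
  case True
  then obtain g where g: "g \<in> borel_measurable (lebesgue_on \<Omega>)" "AE x in lebesgue_on \<Omega>. f x = g x" ..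
  from g(2) have "AE x in lebesgue_on \<Omega>. - f x = - g x" by eventually_elim simp
  from that(2)[OF g(1) ae_class_cong[OF g(2)] ae_class_cong[OF this]] show thesis .
next
  case False
  have "ae_class \<Omega> f = {}"
  proof (rule ccontr)
    assume "ae_class \<Omega> f \<noteq> {}"
    then have "rep (ae_class \<Omega> f) \<in> ae_class \<Omega> f" by (rule rep_in)
    then obtain g where g: "g \<in> borel_measurable (lebesgue_on \<Omega>)" "AE x in lebesgue_on \<Omega>. g x = f x"
      unfolding ae_class_def mem_Collect_eq by (elim conjE) (rule that)
    from g(2) have "AE x in lebesgue_on \<Omega>. f x = g x" by eventually_elim simp
    then have "\<exists>g\<in>borel_measurable (lebesgue_on \<Omega>). AE x in lebesgue_on \<Omega>. f x = g x"
      by (rule bexI[OF _ g(1)])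
    with False show False by (rule notE)
  qed
  moreover have "ae_class \<Omega> (\<lambda>x. - f x) = {}"
  proof (rule ccontr)
    assume "ae_class \<Omega> (\<lambda>x. - f x) \<noteq> {}"
    then have "rep (ae_class \<Omega> (\<lambda>x. - f x)) \<in> ae_class \<Omega> (\<lambda>x. - f x)" by (rule rep_in)
    then obtain g where g: "g \<in> borel_measurable (lebesgue_on \<Omega>)" "AE x in lebesgue_on \<Omega>. g x = - f x"
      unfolding ae_class_def mem_Collect_eq by (elim conjE) (rule that)
    from g(2) have *: "AE x in lebesgue_on \<Omega>. f x = - g x" by eventually_elim simp
    have "(\<lambda>x. - g x) \<in> borel_measurable (lebesgue_on \<Omega>)" using g(1) by simp
    from * have "\<exists>g\<in>borel_measurable (lebesgue_on \<Omega>). AE x in lebesgue_on \<Omega>. f x = g x"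
      by (rule bexI[OF _ \<open>(\<lambda>x. - g x) \<in> _\<close>])
    with False show False by (rule notE)
  qed
  ultimately show thesis by (rule that(1))
qed

lemma L2_norm_class_diff_commute:
  "L2_norm \<Omega> (class_diff \<Omega> U V) = L2_norm \<Omega> (class_diff \<Omega> V U)"
proof -
  have V: "class_diff \<Omega> V U = ae_class \<Omega> (\<lambda>x. - (rep U x - rep V x))"
    by (simp add: class_diff_def)
  show ?thesis unfolding V unfolding class_diff_def
  proof (cases rule: ae_class_minus_cases[of \<Omega> "\<lambda>x. rep U x - rep V x"])
    case 1
    then show "L2_norm \<Omega> (ae_class \<Omega> (\<lambda>x. rep U x - rep V x))
      = L2_norm \<Omega> (ae_class \<Omega> (\<lambda>x. - (rep U x - rep V x)))" by (simp only:)
  next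
    case (2 g)
    have "l2norm (lebesgue_on \<Omega>) (\<lambda>x. - g x) = l2norm (lebesgue_on \<Omega>) g" by (simp add: l2norm_def)
    with 2 show "L2_norm \<Omega> (ae_class \<Omega> (\<lambda>x. rep U x - rep V x))
      = L2_norm \<Omega> (ae_class \<Omega> (\<lambda>x. - (rep U x - rep V x)))"
      by (simp only: L2_norm_ae_class borel_measurable_uminus)
  qed
qed

lemma ae_class_eq_iff:
  assumes f: "square_integrable (lebesgue_on \<Omega>) f" and g: "square_integrable (lebesgue_on \<Omega>) g"
  shows "ae_class \<Omega> f = ae_class \<Omega> g \<longleftrightarrow> l2norm (lebesgue_on \<Omega>) (\<lambda>x. f x - g x) = 0"
proof
  assume eq: "ae_class \<Omega> f = ae_class \<Omega> g"
  note m = square_integrable_measurable[OF f] square_integrable_measurable[OF g]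
  have "AE x in lebesgue_on \<Omega>. f x - g x = 0"
    using rep_ae_class(2)[OF m(1)] rep_ae_class(2)[OF m(2)] unfolding eq by eventually_elim simp
  then show "l2norm (lebesgue_on \<Omega>) (\<lambda>x. f x - g x) = 0"
    by (simp only: l2norm_eq_0_iff[OF square_integrable_diff[OF f g]])
next
  assume "l2norm (lebesgue_on \<Omega>) (\<lambda>x. f x - g x) = 0"
  then have "AE x in lebesgue_on \<Omega>. f x - g x = 0"
    by (simp only: l2norm_eq_0_iff[OF square_integrable_diff[OF f g]])
  then show "ae_class \<Omega> f = ae_class \<Omega> g" by (intro ae_class_cong) simp
qed

lemma Metric_space_L2: "Metric_space (L2 \<Omega>) (\<lambda>U V. L2_norm \<Omega> (class_diff \<Omega> U V))"
proof
  have d: "L2_norm \<Omega> (class_diff \<Omega> U V) = l2norm (lebesgue_on \<Omega>) (\<lambda>x. rep U x - rep V x)"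
    if "U \<in> L2 \<Omega>" "V \<in> L2 \<Omega>" for U V
    using L2_norm_class_diff[OF L2_cases(1) L2_cases(1), OF that] that by (simp add: L2_cases(2))
  fix U V W
  show "0 \<le> L2_norm \<Omega> (class_diff \<Omega> U V)" by (simp add: L2_norm_eq)
  show "L2_norm \<Omega> (class_diff \<Omega> U V) = L2_norm \<Omega> (class_diff \<Omega> V U)" by (rule L2_norm_class_diff_commute)
  assume U: "U \<in> L2 \<Omega>" and V: "V \<in> L2 \<Omega>"
  show "L2_norm \<Omega> (class_diff \<Omega> U V) = 0 \<longleftrightarrow> U = V"
    using ae_class_eq_iff[OF L2_cases(1)[OF U] L2_cases(1)[OF V]] by (simp add: d U V L2_cases(2))
  assume W: "W \<in> L2 \<Omega>"
  show "L2_norm \<Omega> (class_diff \<Omega> U W) \<le> L2_norm \<Omega> (class_diff \<Omega> U V) + L2_norm \<Omega> (class_diff \<Omega> V W)"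
    using l2norm_triangle_diff[OF L2_cases(1)[OF U] L2_cases(1)[OF V] L2_cases(1)[OF W]]
    by (simp add: d U V W)
qed

section \<open>The Sobolev spaces of order two\<close>

context bounded_open
begin

text \<open>The relation \<^const>\<open>is_weak_deriv\<close> for functions, free of the choice of representatives.\<close>

definition weak_partial :: "'a list \<Rightarrow> ('a \<Rightarrow> real) \<Rightarrow> ('a \<Rightarrow> real) \<Rightarrow> bool" where
  "weak_partial bs u g \<longleftrightarrow> (\<forall>\<phi>\<in>test_functions \<Omega>.
     (LINT x|M. u x * partial_derivs bs \<phi> x) = (-1) ^ length bs * (LINT x|M. g x * \<phi> x))"

lemma is_weak_deriv_unique:
  assumes "is_weak_deriv \<Omega> bs U G" "is_weak_deriv \<Omega> bs U H"
  shows "G = H"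
proof -
  have "G \<in> L2 \<Omega>" "H \<in> L2 \<Omega>" using assms by (simp_all add: is_weak_deriv_def)
  note G = L2_cases[OF this(1)] and H = L2_cases[OF this(2)]
  have "AE x in M. rep G x - rep H x = 0"
  proof (rule AE_zero_of_orthogonal[OF square_integrable_diff[OF G(1) H(1)]])
    fix \<phi> assume \<phi>: "\<phi> \<in> test_functions \<Omega>"
    have "(LINT x|M. rep U x * partial_derivs bs \<phi> x) = (-1) ^ length bs * (LINT x|M. rep V x * \<phi> x)"
      if "is_weak_deriv \<Omega> bs U V" for V
      using that \<phi> by (simp add: is_weak_deriv_def)
    from this[OF assms(1)] this[OF assms(2)]
    have "(-1) ^ length bs * (LINT x|M. rep G x * \<phi> x) = (-1) ^ length bs * (LINT x|M. rep H x * \<phi> x)"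
      by (rule trans[OF sym])
    then have "(LINT x|M. rep G x * \<phi> x) = (LINT x|M. rep H x * \<phi> x)" by simp
    then show "(LINT x|M. (rep G x - rep H x) * \<phi> x) = 0"
      using integrable_product[OF G(1) square_integrable_test[OF \<phi>]]
        integrable_product[OF H(1) square_integrable_test[OF \<phi>]]
      by (simp add: left_diff_distrib)
  qed
  then have "ae_class \<Omega> (rep G) = ae_class \<Omega> (rep H)" by (intro ae_class_cong) simp
  then show ?thesis using G H by simp
qed

lemma weak_deriv_eq: "is_weak_deriv \<Omega> bs U G \<Longrightarrow> weak_deriv \<Omega> bs U = G"
  unfolding weak_deriv_def by (rule the_equality) (assumption, rule is_weak_deriv_unique)

lemma is_weak_deriv_ae_class:
  assumes u: "u \<in> borel_measurable M" and g: "square_integrable M g" and bs: "set bs \<subseteq> Basis"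
  shows "is_weak_deriv \<Omega> bs (ae_class \<Omega> u) (ae_class \<Omega> g) \<longleftrightarrow> weak_partial bs u g"
proof -
  have "(LINT x|M. rep (ae_class \<Omega> u) x * partial_derivs bs \<phi> x) = (LINT x|M. u x * partial_derivs bs \<phi> x)"
    "(LINT x|M. rep (ae_class \<Omega> g) x * \<phi> x) = (LINT x|M. g x * \<phi> x)"
    if "\<phi> \<in> test_functions \<Omega>" for \<phi>
    by (rule integral_rep_ae_class[OF u test_measurable[OF test_function_partial_derivs[OF that bs]]],
      rule integral_rep_ae_class[OF square_integrable_measurable[OF g] test_measurable[OF that]])
  then show ?thesis by (simp add: is_weak_deriv_def weak_partial_def ae_class_in_L2[OF g])
qed

abbreviation "D bs U \<equiv> rep (weak_deriv \<Omega> bs U)"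

lemma H2_weak_deriv:
  assumes U: "U \<in> H2 \<Omega>" and bs: "bs \<in> directions2"
  shows "square_integrable M (D bs U)" and "weak_partial bs (rep U) (D bs U)"
proof -
  obtain G where G: "is_weak_deriv \<Omega> bs U G" using U bs by (auto simp: H2_def)
  then have "is_weak_deriv \<Omega> bs U (weak_deriv \<Omega> bs U)" by (simp add: weak_deriv_eq)
  then show "square_integrable M (D bs U)" "weak_partial bs (rep U) (D bs U)"
    using L2_cases(1) by (auto simp: is_weak_deriv_def weak_partial_def)
qed

lemma H2_L2: "U \<in> H2 \<Omega> \<Longrightarrow> U \<in> L2 \<Omega>"
  by (simp add: H2_def)

lemma H2_I:
  assumes u: "square_integrable M u"
    and g: "\<And>bs. bs \<in> directions2 \<Longrightarrow> square_integrable M (g bs) \<and> weak_partial bs u (g bs)"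
  shows "ae_class \<Omega> u \<in> H2 \<Omega>"
    and "bs \<in> directions2 \<Longrightarrow> weak_deriv \<Omega> bs (ae_class \<Omega> u) = ae_class \<Omega> (g bs)"
proof -
  have w: "is_weak_deriv \<Omega> bs (ae_class \<Omega> u) (ae_class \<Omega> (g bs))" if "bs \<in> directions2" for bs
    using g[OF that] is_weak_deriv_ae_class[OF square_integrable_measurable[OF u] _ directions2_Basis[OF that]]
    by blast
  then show "ae_class \<Omega> u \<in> H2 \<Omega>" using ae_class_in_L2[OF u] by (auto simp: H2_def)
  show "bs \<in> directions2 \<Longrightarrow> weak_deriv \<Omega> bs (ae_class \<Omega> u) = ae_class \<Omega> (g bs)"
    by (rule weak_deriv_eq[OF w])
qed

lemma H2_lincomb:
  fixes a b :: real
  assumes U: "U \<in> H2 \<Omega>" and V: "V \<in> H2 \<Omega>"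
  defines "W \<equiv> ae_class \<Omega> (\<lambda>x. a * rep U x + b * rep V x)"
  shows "W \<in> H2 \<Omega>"
    and "bs \<in> directions2 \<Longrightarrow> weak_deriv \<Omega> bs W = ae_class \<Omega> (\<lambda>x. a * D bs U x + b * D bs V x)"
proof -
  note sU = L2_cases(1)[OF H2_L2[OF U]] and sV = L2_cases(1)[OF H2_L2[OF V]]
  have sq: "square_integrable M (\<lambda>x. a * rep U x + b * rep V x)"
    by (intro square_integrable_add square_integrable_cmult sU sV)
  have g: "square_integrable M (\<lambda>x. a * D bs U x + b * D bs V x) \<and>
      weak_partial bs (\<lambda>x. a * rep U x + b * rep V x) (\<lambda>x. a * D bs U x + b * D bs V x)"
    if bs: "bs \<in> directions2" for bs
  proof
    note dU = H2_weak_deriv[OF U bs] and dV = H2_weak_deriv[OF V bs]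
    show "square_integrable M (\<lambda>x. a * D bs U x + b * D bs V x)"
      by (intro square_integrable_add square_integrable_cmult dU dV)
    have lin: "(LINT x|M. (a * f x + b * g x) * h x) = a * (LINT x|M. f x * h x) + b * (LINT x|M. g x * h x)"
      if "square_integrable M f" "square_integrable M g" "square_integrable M h" for f g h
    proof -
      have "(LINT x|M. (a * f x + b * g x) * h x) = (LINT x|M. a * (f x * h x) + b * (g x * h x))"
        by (simp add: algebra_simps)
      then show ?thesis using integrable_product[OF that(1,3)] integrable_product[OF that(2,3)] by simp
    qed
    show "weak_partial bs (\<lambda>x. a * rep U x + b * rep V x) (\<lambda>x. a * D bs U x + b * D bs V x)"
      unfolding weak_partial_def
    proof
      fix \<phi> assume \<phi>: "\<phi> \<in> test_functions \<Omega>"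
      note s1 = square_integrable_test[OF \<phi>]
        and s2 = square_integrable_test[OF test_function_partial_derivs[OF \<phi> directions2_Basis[OF bs]]]
      show "(LINT x|M. (a * rep U x + b * rep V x) * partial_derivs bs \<phi> x)
        = (-1) ^ length bs * (LINT x|M. (a * D bs U x + b * D bs V x) * \<phi> x)"
        unfolding lin[OF sU sV s2] lin[OF dU(1) dV(1) s1]
        using dU(2) dV(2) \<phi> unfolding weak_partial_def by (simp add: algebra_simps)
    qed
  qed
  show "W \<in> H2 \<Omega>" unfolding W_def by (rule H2_I(1)[OF sq g])
  show "weak_deriv \<Omega> bs W = ae_class \<Omega> (\<lambda>x. a * D bs U x + b * D bs V x)" if "bs \<in> directions2"
    unfolding W_def by (rule H2_I(2)[OF sq g that])
qed

lemma weak_partial_test: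
  assumes \<phi>: "\<phi> \<in> test_functions \<Omega>" and bs: "bs \<in> directions2"
  shows "weak_partial bs \<phi> (partial_derivs bs \<phi>)"
  unfolding weak_partial_def
proof
  fix \<psi> assume \<psi>: "\<psi> \<in> test_functions \<Omega>"
  note s = test_function_smooth[OF \<phi>]
  from bs show "(LINT x|M. \<phi> x * partial_derivs bs \<psi> x) = (-1) ^ length bs * (LINT x|M. partial_derivs bs \<phi> x * \<psi> x)"
  proof (cases rule: directions2_cases)
    case 1
    then show ?thesis by simp
  next
    case (2 i)
    then show ?thesis using integration_by_parts[OF s \<psi>] by simp
  next
    case (3 i j)
    note i = 3(1) and j = 3(2)
    show ?thesis
      using integration_by_parts[OF s test_function_partial_deriv[OF \<psi> j] i]
        integration_by_parts[OF smooth_partial_deriv[OF s i] \<psi> j]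
        smooth_partial_deriv_commute[OF s i j]
      by (simp add: 3(3))
  qed
qed

lemma test_in_H2:
  assumes \<phi>: "\<phi> \<in> test_functions \<Omega>"
  shows "ae_class \<Omega> \<phi> \<in> H2 \<Omega>"
    and "bs \<in> directions2 \<Longrightarrow> weak_deriv \<Omega> bs (ae_class \<Omega> \<phi>) = ae_class \<Omega> (partial_derivs bs \<phi>)"
proof -
  have *: "square_integrable M (partial_derivs bs \<phi>) \<and> weak_partial bs \<phi> (partial_derivs bs \<phi>)"
    if "bs \<in> directions2" for bs
    using that by (intro conjI weak_partial_test \<phi> square_integrable_test test_function_partial_derivs directions2_Basis)
  show "ae_class \<Omega> \<phi> \<in> H2 \<Omega>" by (rule H2_I(1)[OF square_integrable_test[OF \<phi>] *])
  show "bs \<in> directions2 \<Longrightarrow> weak_deriv \<Omega> bs (ae_class \<Omega> \<phi>) = ae_class \<Omega> (partial_derivs bs \<phi>)"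
    by (rule H2_I(2)[OF square_integrable_test[OF \<phi>] *])
qed

lemma H2_norm_class_diff:
  assumes U: "U \<in> H2 \<Omega>" and V: "V \<in> H2 \<Omega>"
  shows "H2_norm \<Omega> (class_diff \<Omega> U V) = L2_set (\<lambda>bs. l2norm M (\<lambda>x. D bs U x - D bs V x)) directions2"
proof -
  have "L2_norm \<Omega> (weak_deriv \<Omega> bs (class_diff \<Omega> U V)) = l2norm M (\<lambda>x. D bs U x - D bs V x)"
    if bs: "bs \<in> directions2" for bs
  proof -
    have "weak_deriv \<Omega> bs (class_diff \<Omega> U V) = ae_class \<Omega> (\<lambda>x. D bs U x - D bs V x)"
      using H2_lincomb(2)[OF U V bs, of 1 "-1"] by (simp add: class_diff_def)
    then show ?thesis
      using square_integrable_measurable[OF square_integrable_diff[OF H2_weak_deriv(1)[OF U bs] H2_weak_deriv(1)[OF V bs]]]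
      by (simp add: L2_norm_ae_class)
  qed
  then show ?thesis by (simp add: H2_norm_def L2_set_def)
qed

text \<open>Symmetry of the \<open>H2\<close> distance is again required for all arguments. Where no weak derivative exists,
  \<open>weak_deriv\<close> is the same default value for a class and its negative.\<close>

lemma L2_norm_weak_deriv_minus:
  assumes g: "g \<in> borel_measurable M" and bs: "bs \<in> directions2"
  shows "L2_norm \<Omega> (weak_deriv \<Omega> bs (ae_class \<Omega> g)) = L2_norm \<Omega> (weak_deriv \<Omega> bs (ae_class \<Omega> (\<lambda>x. - g x)))"
proof -
  have step: "\<exists>h. square_integrable M h \<and> is_weak_deriv \<Omega> bs (ae_class \<Omega> g) (ae_class \<Omega> h) \<and>
       is_weak_deriv \<Omega> bs (ae_class \<Omega> (\<lambda>x. - g x)) (ae_class \<Omega> (\<lambda>x. - h x))"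
    if g: "g \<in> borel_measurable M" and G: "is_weak_deriv \<Omega> bs (ae_class \<Omega> g) G" for g G
  proof -
    have L: "G \<in> L2 \<Omega>" using G by (simp add: is_weak_deriv_def)
    note r = L2_cases[OF L]
    have "weak_partial bs g (rep G)"
      using G is_weak_deriv_ae_class[OF g r(1) directions2_Basis[OF bs]] r(2) by simp
    then have w: "weak_partial bs (\<lambda>x. - g x) (\<lambda>x. - rep G x)" by (simp add: weak_partial_def)
    have mg: "(\<lambda>x. - g x) \<in> borel_measurable M" using g by simp
    have "square_integrable M (\<lambda>x. - rep G x)" using square_integrable_cmult[OF r(1), of "-1"] by simp
    from w is_weak_deriv_ae_class[OF mg this directions2_Basis[OF bs]] r G show ?thesis by auto
  qed
  show ?thesis
  proof (cases "\<exists>G. is_weak_deriv \<Omega> bs (ae_class \<Omega> g) G")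
    case True
    then obtain h where h: "square_integrable M h" "is_weak_deriv \<Omega> bs (ae_class \<Omega> g) (ae_class \<Omega> h)"
       "is_weak_deriv \<Omega> bs (ae_class \<Omega> (\<lambda>x. - g x)) (ae_class \<Omega> (\<lambda>x. - h x))"
      using step[OF g] by blast
    have "l2norm M (\<lambda>x. - h x) = l2norm M h" by (simp add: l2norm_def)
    then show ?thesis
      unfolding weak_deriv_eq[OF h(2)] weak_deriv_eq[OF h(3)]
      using square_integrable_measurable[OF h(1)] by (simp add: L2_norm_ae_class)
  next
    case False
    have mg: "(\<lambda>x. - g x) \<in> borel_measurable M" using g by simp
    have "\<not> is_weak_deriv \<Omega> bs (ae_class \<Omega> (\<lambda>x. - g x)) G" for G
      using step[OF mg, of G] False by auto
    with False have "is_weak_deriv \<Omega> bs (ae_class \<Omega> g) = is_weak_deriv \<Omega> bs (ae_class \<Omega> (\<lambda>x. - g x))"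
      by (simp add: fun_eq_iff)
    then show ?thesis by (simp add: weak_deriv_def)
  qed
qed

lemma H2_norm_class_diff_commute: "H2_norm \<Omega> (class_diff \<Omega> U V) = H2_norm \<Omega> (class_diff \<Omega> V U)"
proof -
  let ?f = "\<lambda>x. rep U x - rep V x"
  have V: "class_diff \<Omega> V U = ae_class \<Omega> (\<lambda>x. - ?f x)" by (simp add: class_diff_def)
  have U: "class_diff \<Omega> U V = ae_class \<Omega> ?f" by (simp add: class_diff_def)
  show ?thesis
  proof (cases rule: ae_class_minus_cases[of \<Omega> ?f])
    case 1
    then show ?thesis unfolding U V by (simp only:)
  next
    case (2 g)
    show ?thesis unfolding U V 2(2,3) H2_norm_def
      by (simp add: L2_norm_weak_deriv_minus[OF 2(1)])
  qed
qed

lemma weak_deriv_Nil: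
  assumes U: "U \<in> L2 \<Omega>" shows "weak_deriv \<Omega> [] U = U"
  by (rule weak_deriv_eq) (simp add: is_weak_deriv_def U)

lemma Metric_space_H2: "Metric_space (H2 \<Omega>) (\<lambda>U V. H2_norm \<Omega> (class_diff \<Omega> U V))"
proof
  fix U V W
  show "0 \<le> H2_norm \<Omega> (class_diff \<Omega> U V)" by (simp add: H2_norm_def sum_nonneg)
  show "H2_norm \<Omega> (class_diff \<Omega> U V) = H2_norm \<Omega> (class_diff \<Omega> V U)" by (rule H2_norm_class_diff_commute)
  assume U: "U \<in> H2 \<Omega>" and V: "V \<in> H2 \<Omega>"
  show "H2_norm \<Omega> (class_diff \<Omega> U V) = 0 \<longleftrightarrow> U = V"
  proof
    assume "H2_norm \<Omega> (class_diff \<Omega> U V) = 0"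
    then have "l2norm M (\<lambda>x. D [] U x - D [] V x) = 0"
      using Nil_directions2[where 'a = 'a] by (simp add: H2_norm_class_diff[OF U V] L2_set_eq_0_iff finite_directions2)
    then show "U = V"
      using ae_class_eq_iff[OF L2_cases(1)[OF H2_L2[OF U]] L2_cases(1)[OF H2_L2[OF V]]]
      by (simp add: weak_deriv_Nil H2_L2 U V L2_cases(2))
  next
    assume "U = V"
    then show "H2_norm \<Omega> (class_diff \<Omega> U V) = 0"
      using H2_norm_class_diff[OF U U] by (simp add: l2norm_def L2_set_def)
  qed
  assume W: "W \<in> H2 \<Omega>"
  have "H2_norm \<Omega> (class_diff \<Omega> U W)
      \<le> L2_set (\<lambda>bs. l2norm M (\<lambda>x. D bs U x - D bs V x) + l2norm M (\<lambda>x. D bs V x - D bs W x)) directions2"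
    unfolding H2_norm_class_diff[OF U W]
    by (intro L2_set_mono l2norm_triangle_diff H2_weak_deriv(1) U V W) auto
  also have "\<dots> \<le> H2_norm \<Omega> (class_diff \<Omega> U V) + H2_norm \<Omega> (class_diff \<Omega> V W)"
    unfolding H2_norm_class_diff[OF U V] H2_norm_class_diff[OF V W] by (rule L2_set_triangle_ineq)
  finally show "H2_norm \<Omega> (class_diff \<Omega> U W) \<le> H2_norm \<Omega> (class_diff \<Omega> U V) + H2_norm \<Omega> (class_diff \<Omega> V W)" .
qed

definition H2_approximates :: "(nat \<Rightarrow> 'a \<Rightarrow> real) \<Rightarrow> ('a \<Rightarrow> real) set \<Rightarrow> bool" where
  "H2_approximates \<phi> U \<longleftrightarrow> (\<forall>n. \<phi> n \<in> test_functions \<Omega>) \<and>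
     (\<forall>bs\<in>directions2. (\<lambda>n. l2norm M (\<lambda>x. partial_derivs bs (\<phi> n) x - D bs U x)) \<longlonglongrightarrow> 0)"

lemma H2_dist_test:
  assumes U: "U \<in> H2 \<Omega>" and \<phi>: "\<phi> \<in> test_functions \<Omega>"
  shows "H2_norm \<Omega> (class_diff \<Omega> U (ae_class \<Omega> \<phi>))
    = L2_set (\<lambda>bs. l2norm M (\<lambda>x. partial_derivs bs \<phi> x - D bs U x)) directions2"
  unfolding H2_norm_class_diff[OF U test_in_H2(1)[OF \<phi>]]
proof (rule L2_set_cong[OF refl])
  fix bs :: "'a list" assume bs: "bs \<in> directions2"
  have m: "partial_derivs bs \<phi> \<in> borel_measurable M"
    by (intro test_measurable test_function_partial_derivs \<phi> directions2_Basis bs)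
  have "l2norm M (\<lambda>x. D bs U x - D bs (ae_class \<Omega> \<phi>) x) = l2norm M (\<lambda>x. D bs U x - partial_derivs bs \<phi> x)"
    unfolding test_in_H2(2)[OF \<phi> bs]
  proof (rule l2norm_cong_AE)
    show "AE x in M. D bs U x - rep (ae_class \<Omega> (partial_derivs bs \<phi>)) x = D bs U x - partial_derivs bs \<phi> x"
      using rep_ae_class(2)[OF m] by eventually_elim simp
  qed (use square_integrable_measurable[OF H2_weak_deriv(1)[OF U bs]] m rep_ae_class(1)[OF m] in auto)
  then show "l2norm M (\<lambda>x. D bs U x - D bs (ae_class \<Omega> \<phi>) x) = l2norm M (\<lambda>x. partial_derivs bs \<phi> x - D bs U x)"
    using l2norm_minus_commute by metis
qed

lemma H2_0_iff: "U \<in> H2_0 \<Omega> \<longleftrightarrow> U \<in> H2 \<Omega> \<and> (\<exists>\<phi>. H2_approximates \<phi> U)"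
proof -
  interpret H: Metric_space "H2 \<Omega>" "\<lambda>U V. H2_norm \<Omega> (class_diff \<Omega> U V)" by (rule Metric_space_H2)
  have iff: "U \<in> H2_0 \<Omega> \<longleftrightarrow> U \<in> H2 \<Omega> \<and> (\<forall>r>0. \<exists>\<phi>\<in>test_functions \<Omega>. H2_norm \<Omega> (class_diff \<Omega> U (ae_class \<Omega> \<phi>)) < r)"
    unfolding H2_0_def H2_topology_def H.metric_closure_of using test_in_H2(1) by auto
  show ?thesis
  proof
    assume "U \<in> H2_0 \<Omega>"
    then have U: "U \<in> H2 \<Omega>"
      and ex: "\<forall>r>0. \<exists>\<phi>\<in>test_functions \<Omega>. H2_norm \<Omega> (class_diff \<Omega> U (ae_class \<Omega> \<phi>)) < r"
      using iff by auto
    have "\<forall>n. \<exists>\<phi>. \<phi> \<in> test_functions \<Omega> \<and> H2_norm \<Omega> (class_diff \<Omega> U (ae_class \<Omega> \<phi>)) < inverse (real (Suc n))"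
      using ex by (auto simp: Bex_def)
    then obtain \<phi> where \<phi>: "\<And>n. \<phi> n \<in> test_functions \<Omega>"
      and lt: "\<And>n. H2_norm \<Omega> (class_diff \<Omega> U (ae_class \<Omega> (\<phi> n))) < inverse (real (Suc n))"
      by metis
    have "(\<lambda>n. l2norm M (\<lambda>x. partial_derivs bs (\<phi> n) x - D bs U x)) \<longlonglongrightarrow> 0" if bs: "bs \<in> directions2" for bs
    proof (rule Lim_null_comparison[OF _ LIMSEQ_inverse_real_of_nat], rule always_eventually, rule allI)
      fix n
      have "l2norm M (\<lambda>x. partial_derivs bs (\<phi> n) x - D bs U x) \<le> H2_norm \<Omega> (class_diff \<Omega> U (ae_class \<Omega> (\<phi> n)))"
        unfolding H2_dist_test[OF U \<phi>] using bs by (rule member_le_L2_set[OF finite_directions2])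
      then show "norm (l2norm M (\<lambda>x. partial_derivs bs (\<phi> n) x - D bs U x)) \<le> inverse (real (Suc n))"
        using lt[of n] by simp
    qed
    then show "U \<in> H2 \<Omega> \<and> (\<exists>\<phi>. H2_approximates \<phi> U)" using U \<phi> by (auto simp: H2_approximates_def)
  next
    assume "U \<in> H2 \<Omega> \<and> (\<exists>\<phi>. H2_approximates \<phi> U)"
    then obtain \<phi> where U: "U \<in> H2 \<Omega>" and \<phi>: "\<And>n. \<phi> n \<in> test_functions \<Omega>" and
      lim: "\<And>bs. bs \<in> directions2 \<Longrightarrow> (\<lambda>n. l2norm M (\<lambda>x. partial_derivs bs (\<phi> n) x - D bs U x)) \<longlonglongrightarrow> 0"
      by (auto simp: H2_approximates_def)
    have "(\<lambda>n. H2_norm \<Omega> (class_diff \<Omega> U (ae_class \<Omega> (\<phi> n)))) \<longlonglongrightarrow> 0"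
    proof (rule Lim_null_comparison[OF always_eventually[OF allI]])
      show "norm (H2_norm \<Omega> (class_diff \<Omega> U (ae_class \<Omega> (\<phi> n))))
        \<le> (\<Sum>bs\<in>directions2. l2norm M (\<lambda>x. partial_derivs bs (\<phi> n) x - D bs U x))" for n
        unfolding H2_dist_test[OF U \<phi>] by (simp add: L2_set_le_sum)
      show "(\<lambda>n. \<Sum>bs\<in>directions2. l2norm M (\<lambda>x. partial_derivs bs (\<phi> n) x - D bs U x)) \<longlonglongrightarrow> 0"
        using tendsto_sum[OF lim, of directions2 "\<lambda>x. x"] by simp
    qed
    from eventually_happens'[OF sequentially_bot order_tendstoD(2)[OF this]]
    have "\<exists>n. H2_norm \<Omega> (class_diff \<Omega> U (ae_class \<Omega> (\<phi> n))) < r" if "r > 0" for r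
      using that by simp
    then show "U \<in> H2_0 \<Omega>" unfolding iff using U \<phi> by blast
  qed
qed

end

section \<open>The Laplacian as an isomorphism\<close>

lemma homeomorphic_map_bi_Lipschitz:
  assumes M: "Metric_space M d" and M': "Metric_space M' d'" and S: "S \<subseteq> M" and S': "S' \<subseteq> M'"
    and bij: "bij_betw T S S'"
    and upper: "\<And>x y. x \<in> S \<Longrightarrow> y \<in> S \<Longrightarrow> d' (T x) (T y) \<le> K * d x y"
    and lower: "\<And>x y. x \<in> S \<Longrightarrow> y \<in> S \<Longrightarrow> d x y \<le> K' * d' (T x) (T y)"
  shows "homeomorphic_map (subtopology (Metric_space.mtopology M d) S)
    (subtopology (Metric_space.mtopology M' d') S') T"
proof -
  interpret A: Submetric M d S using M S by (simp add: Submetric_def Submetric_axioms_def)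
  interpret B: Submetric M' d' S' using M' S' by (simp add: Submetric_def Submetric_axioms_def)
  have cont: "\<forall>a\<in>X. \<forall>e>0. \<exists>\<delta>>0. \<forall>x. x \<in> X \<and> p a x < \<delta> \<longrightarrow> q (f a) (f x) < e"
    if "\<And>x y. x \<in> X \<Longrightarrow> y \<in> X \<Longrightarrow> q (f x) (f y) \<le> c * p x y" "\<And>x y. 0 \<le> p x y"
    for X f c and p :: "'x \<Rightarrow> 'x \<Rightarrow> real" and q :: "'y \<Rightarrow> 'y \<Rightarrow> real"
  proof (intro ballI allI impI)
    fix a and e :: real assume a: "a \<in> X" and e: "0 < e"
    have "q (f a) (f x) < e" if x: "x \<in> X" and "p a x < e / (\<bar>c\<bar> + 1)" for x
    proof -
      have "q (f a) (f x) \<le> c * p a x" by (rule \<open>\<And>x y. _ \<Longrightarrow> _ \<Longrightarrow> q (f x) (f y) \<le> c * p x y\<close>[OF a x])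
      also have "\<dots> \<le> (\<bar>c\<bar> + 1) * p a x" by (intro mult_right_mono \<open>\<And>x y. 0 \<le> p x y\<close>) simp
      also have "\<dots> < e" using \<open>p a x < e / (\<bar>c\<bar> + 1)\<close> by (simp add: pos_less_divide_eq add_nonneg_pos mult.commute)
      finally show ?thesis .
    qed
    moreover have "0 < e / (\<bar>c\<bar> + 1)" using e by (simp add: add_nonneg_pos)
    ultimately show "\<exists>\<delta>>0. \<forall>x. x \<in> X \<and> p a x < \<delta> \<longrightarrow> q (f a) (f x) < e" by blast
  qed
  define G where "G = inv_into S T"
  have T: "T ` S = S'" "inj_on T S" using bij by (auto simp: bij_betw_def)
  have G: "G y \<in> S" "T (G y) = y" if "y \<in> S'" for y
    using that T by (auto simp: G_def inv_into_into f_inv_into_f)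
  have GT: "G (T x) = x" if "x \<in> S" for x using that T by (simp add: G_def)
  have "continuous_map A.sub.mtopology B.sub.mtopology T"
    unfolding A.sub.metric_continuous_map[OF B.sub.Metric_space_axioms]
    using cont[of S d' T K d] upper T(1) by simp
  moreover have "continuous_map B.sub.mtopology A.sub.mtopology G"
  proof -
    have low: "d (G x) (G y) \<le> K' * d' x y" if "x \<in> S'" "y \<in> S'" for x y
      using lower[OF G(1)[OF that(1)] G(1)[OF that(2)]] by (simp add: G(2) that)
    have "G ` S' \<subseteq> S" using G(1) by blast
    with cont[of S' d G K' d', OF low] show ?thesis
      unfolding B.sub.metric_continuous_map[OF A.sub.Metric_space_axioms] by simp
  qed
  ultimately have "homeomorphic_maps A.sub.mtopology B.sub.mtopology T G"
    using GT G(2) by (simp add: homeomorphic_maps_def)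
  then show ?thesis
    unfolding A.mtopology_submetric B.mtopology_submetric by (rule homeomorphic_maps_imp_map)
qed

context bounded_open
begin

definition laplacian_rep :: "('a \<Rightarrow> real) set \<Rightarrow> 'a \<Rightarrow> real" where
  "laplacian_rep U x = (\<Sum>b\<in>Basis. D [b, b] U x)"

lemma weak_laplacian_eq: "weak_laplacian \<Omega> U = ae_class \<Omega> (laplacian_rep U)"
  by (simp add: weak_laplacian_def laplacian_rep_def[abs_def])

lemma square_integrable_laplacian_rep: "U \<in> H2 \<Omega> \<Longrightarrow> square_integrable M (laplacian_rep U)"
  unfolding laplacian_rep_def[abs_def] by (intro square_integrable_sum H2_weak_deriv(1) pair_directions2)

lemma weak_laplacian_L2: "U \<in> H2 \<Omega> \<Longrightarrow> weak_laplacian \<Omega> U \<in> L2 \<Omega>"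
  unfolding weak_laplacian_eq by (intro ae_class_in_L2 square_integrable_laplacian_rep)

lemma weak_laplacian_dist:
  assumes "U \<in> H2 \<Omega>" "V \<in> H2 \<Omega>"
  shows "L2_norm \<Omega> (class_diff \<Omega> (weak_laplacian \<Omega> U) (weak_laplacian \<Omega> V)) = l2norm M (\<lambda>x. laplacian_rep U x - laplacian_rep V x)"
  unfolding weak_laplacian_eq by (intro L2_norm_class_diff square_integrable_laplacian_rep assms)

lemma weak_laplacian_lincomb:
  fixes a b :: real
  assumes U: "U \<in> H2 \<Omega>" and V: "V \<in> H2 \<Omega>"
  shows "weak_laplacian \<Omega> (ae_class \<Omega> (\<lambda>x. a * rep U x + b * rep V x))
    = ae_class \<Omega> (\<lambda>x. a * rep (weak_laplacian \<Omega> U) x + b * rep (weak_laplacian \<Omega> V) x)"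
proof -
  let ?W = "ae_class \<Omega> (\<lambda>x. a * rep U x + b * rep V x)"
  have m: "(\<lambda>x. a * D [i, i] U x + b * D [i, i] V x) \<in> borel_measurable M" if "i \<in> Basis" for i
    by (intro square_integrable_measurable square_integrable_add square_integrable_cmult
        H2_weak_deriv(1) U V pair_directions2 that)
  have "AE x in M. D [i, i] ?W x = a * D [i, i] U x + b * D [i, i] V x" if i: "i \<in> Basis" for i
    unfolding H2_lincomb(2)[OF U V pair_directions2[OF i]] by (rule rep_ae_class(2)[OF m[OF i]])
  then have "AE x in M. \<forall>i\<in>Basis. D [i, i] ?W x = a * D [i, i] U x + b * D [i, i] V x"
    by (intro AE_finite_allI finite_Basis)
  then have "AE x in M. laplacian_rep ?W x = a * laplacian_rep U x + b * laplacian_rep V x"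
    by eventually_elim (simp add: laplacian_rep_def sum.distrib sum_distrib_left)
  moreover have "AE x in M. rep (weak_laplacian \<Omega> U) x = laplacian_rep U x" "AE x in M. rep (weak_laplacian \<Omega> V) x = laplacian_rep V x"
    unfolding weak_laplacian_eq
    by (intro rep_ae_class(2) square_integrable_measurable square_integrable_laplacian_rep U V)+
  ultimately have "AE x in M. laplacian_rep ?W x = a * rep (weak_laplacian \<Omega> U) x + b * rep (weak_laplacian \<Omega> V) x"
    by eventually_elim simp
  then show ?thesis unfolding weak_laplacian_eq[of ?W] by (rule ae_class_cong)
qed

lemma weak_laplacian_add:
  "U \<in> H2 \<Omega> \<Longrightarrow> V \<in> H2 \<Omega> \<Longrightarrow>
    weak_laplacian \<Omega> (class_add \<Omega> U V) = class_add \<Omega> (weak_laplacian \<Omega> U) (weak_laplacian \<Omega> V)"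
  using weak_laplacian_lincomb[of U V 1 1] by (simp add: class_add_def)

lemma weak_laplacian_scale:
  "U \<in> H2 \<Omega> \<Longrightarrow> weak_laplacian \<Omega> (class_scale \<Omega> c U) = class_scale \<Omega> c (weak_laplacian \<Omega> U)"
  using weak_laplacian_lincomb[of U U c 0] by (simp add: class_scale_def)

lemma H2_approximates_laplacian:
  assumes U: "U \<in> H2 \<Omega>" and \<phi>: "H2_approximates \<phi> U"
  shows "(\<lambda>n. l2norm M (\<lambda>x. laplacian (\<phi> n) x - laplacian_rep U x)) \<longlonglongrightarrow> 0"
  unfolding laplacian_def laplacian_rep_def
proof (rule l2norm_sum_limit[OF finite_Basis])
  fix b :: 'a and n assume b: "b \<in> Basis"
  note bb = pair_directions2[OF b]
  have "\<phi> n \<in> test_functions \<Omega>" for n using \<phi> by (simp add: H2_approximates_def)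
  then show "square_integrable M (partial_derivs [b, b] (\<phi> n))"
    by (intro square_integrable_test test_function_partial_derivs) (use b in auto)
  show "square_integrable M (D [b, b] U)" by (rule H2_weak_deriv(1)[OF U bb])
  show "(\<lambda>n. l2norm M (\<lambda>x. partial_derivs [b, b] (\<phi> n) x - D [b, b] U x)) \<longlonglongrightarrow> 0"
    using \<phi> bb unfolding H2_approximates_def by blast
qed

lemma laplacian_add:
  assumes "\<phi> \<in> test_functions \<Omega>" "\<psi> \<in> test_functions \<Omega>"
  shows "laplacian (\<lambda>x. \<phi> x + \<psi> x) = (\<lambda>x. laplacian \<phi> x + laplacian \<psi> x)"
  using partial_derivs_add[OF assms[THEN test_function_smooth]]
  by (simp add: laplacian_def fun_eq_iff sum.distrib del: partial_derivs_Cons)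

lemma laplacian_cmult:
  assumes "\<phi> \<in> test_functions \<Omega>"
  shows "laplacian (\<lambda>x. c * \<phi> x) = (\<lambda>x. c * laplacian \<phi> x)"
  using partial_derivs_cmult[OF assms[THEN test_function_smooth]]
  by (simp add: laplacian_def fun_eq_iff sum_distrib_left del: partial_derivs_Cons)

lemma test_diff:
  assumes \<phi>: "\<phi> \<in> test_functions \<Omega>" and \<psi>: "\<psi> \<in> test_functions \<Omega>"
  shows "(\<lambda>x. \<phi> x - \<psi> x) \<in> test_functions \<Omega>"
    and "laplacian (\<lambda>x. \<phi> x - \<psi> x) = (\<lambda>x. laplacian \<phi> x - laplacian \<psi> x)"
    and "set bs \<subseteq> Basis \<Longrightarrow>
      partial_derivs bs (\<lambda>x. \<phi> x - \<psi> x) = (\<lambda>x. partial_derivs bs \<phi> x - partial_derivs bs \<psi> x)"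
proof -
  have eq: "(\<lambda>x. \<phi> x - \<psi> x) = (\<lambda>x. \<phi> x + (-1) * \<psi> x)" by simp
  have m: "(\<lambda>x. (-1) * \<psi> x) \<in> test_functions \<Omega>" by (rule test_function_cmult[OF \<psi>])
  show "(\<lambda>x. \<phi> x - \<psi> x) \<in> test_functions \<Omega>"
    unfolding eq by (rule test_function_add[OF \<phi> m])
  show "laplacian (\<lambda>x. \<phi> x - \<psi> x) = (\<lambda>x. laplacian \<phi> x - laplacian \<psi> x)"
    unfolding eq laplacian_add[OF \<phi> m] laplacian_cmult[OF \<psi>] by simp
  show "partial_derivs bs (\<lambda>x. \<phi> x - \<psi> x) = (\<lambda>x. partial_derivs bs \<phi> x - partial_derivs bs \<psi> x)"
    if "set bs \<subseteq> Basis"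
    unfolding eq partial_derivs_add[OF test_function_smooth[OF \<phi>] test_function_smooth[OF m] that]
      partial_derivs_cmult[OF test_function_smooth[OF \<psi>] that] by simp
qed

lemma l2norm_diff_limit:
  assumes f: "\<And>n. square_integrable M (f n)" "square_integrable M f'" "(\<lambda>n. l2norm M (\<lambda>x. f n x - f' x)) \<longlonglongrightarrow> 0"
    and g: "\<And>n. square_integrable M (g n)" "square_integrable M g'" "(\<lambda>n. l2norm M (\<lambda>x. g n x - g' x)) \<longlonglongrightarrow> 0"
  shows "(\<lambda>n. l2norm M (\<lambda>x. f n x - g n x)) \<longlonglongrightarrow> l2norm M (\<lambda>x. f' x - g' x)"
proof (rule l2norm_tendsto)
  show "(\<lambda>n. l2norm M (\<lambda>x. (f n x - g n x) - (f' x - g' x))) \<longlonglongrightarrow> 0"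
  proof (rule Lim_null_comparison[OF always_eventually[OF allI]])
    fix n
    have "l2norm M (\<lambda>x. (f n x - f' x) + (g' x - g n x)) \<le> l2norm M (\<lambda>x. f n x - f' x) + l2norm M (\<lambda>x. g' x - g n x)"
      by (intro l2norm_triangle square_integrable_diff f g)
    moreover have "(\<lambda>x. (f n x - f' x) + (g' x - g n x)) = (\<lambda>x. (f n x - g n x) - (f' x - g' x))"
      by (simp add: fun_eq_iff)
    ultimately show "norm (l2norm M (\<lambda>x. (f n x - g n x) - (f' x - g' x)))
        \<le> l2norm M (\<lambda>x. f n x - f' x) + l2norm M (\<lambda>x. g n x - g' x)"
      by (simp add: l2norm_minus_commute[of M g'])
  next
    show "(\<lambda>n. l2norm M (\<lambda>x. f n x - f' x) + l2norm M (\<lambda>x. g n x - g' x)) \<longlonglongrightarrow> 0"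
      using tendsto_add[OF f(3) g(3)] by simp
  qed
qed (intro square_integrable_diff f g)+

text \<open>The a priori estimate for test functions survives the passage to the limit. Stated for differences,
  it gives injectivity and the continuity of the inverse at once.\<close>

lemma H2_0_estimate:
  "\<exists>C. \<forall>U\<in>H2_0 \<Omega>. \<forall>V\<in>H2_0 \<Omega>. H2_norm \<Omega> (class_diff \<Omega> U V) \<le> C * l2norm M (\<lambda>x. laplacian_rep U x - laplacian_rep V x)"
proof -
  obtain K where K: "\<forall>bs\<in>directions2. \<forall>\<phi>\<in>test_functions \<Omega>.
    l2norm M (partial_derivs bs \<phi>) \<le> K * l2norm M (laplacian \<phi>)"
    using laplacian_bounds_derivs by blast
  have "H2_norm \<Omega> (class_diff \<Omega> U V)
      \<le> (real (card (directions2 :: 'a list set)) * K) * l2norm M (\<lambda>x. laplacian_rep U x - laplacian_rep V x)"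
    if U0: "U \<in> H2_0 \<Omega>" and V0: "V \<in> H2_0 \<Omega>" for U V
  proof -
    from U0 obtain \<phi> where U: "U \<in> H2 \<Omega>" and cU: "H2_approximates \<phi> U" by (auto simp: H2_0_iff)
    from V0 obtain \<psi> where V: "V \<in> H2 \<Omega>" and cV: "H2_approximates \<psi> V" by (auto simp: H2_0_iff)
    have \<phi>: "\<And>n. \<phi> n \<in> test_functions \<Omega>" and \<psi>: "\<And>n. \<psi> n \<in> test_functions \<Omega>"
      using cU cV by (simp_all add: H2_approximates_def)
    have est: "l2norm M (\<lambda>x. D bs U x - D bs V x) \<le> K * l2norm M (\<lambda>x. laplacian_rep U x - laplacian_rep V x)"
      if bs: "bs \<in> directions2" for bs
    proof (rule LIMSEQ_le)
      show "(\<lambda>n. l2norm M (\<lambda>x. partial_derivs bs (\<phi> n) x - partial_derivs bs (\<psi> n) x))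
          \<longlonglongrightarrow> l2norm M (\<lambda>x. D bs U x - D bs V x)"
      proof (rule l2norm_diff_limit)
        show "square_integrable M (partial_derivs bs (\<phi> n))" "square_integrable M (partial_derivs bs (\<psi> n))" for n
          by (intro square_integrable_test test_function_partial_derivs \<phi> \<psi> directions2_Basis bs)+
        show "square_integrable M (D bs U)" "square_integrable M (D bs V)"
          by (intro H2_weak_deriv(1) U V bs)+
      qed (use cU cV bs in \<open>simp_all add: H2_approximates_def\<close>)
      have "(\<lambda>n. l2norm M (\<lambda>x. laplacian (\<phi> n) x - laplacian (\<psi> n) x)) \<longlonglongrightarrow> l2norm M (\<lambda>x. laplacian_rep U x - laplacian_rep V x)"
        by (intro l2norm_diff_limit square_integrable_test test_function_laplacian \<phi> \<psi>
            square_integrable_laplacian_rep H2_approximates_laplacian U V cU cV)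
      then show "(\<lambda>n. K * l2norm M (\<lambda>x. laplacian (\<phi> n) x - laplacian (\<psi> n) x))
          \<longlonglongrightarrow> K * l2norm M (\<lambda>x. laplacian_rep U x - laplacian_rep V x)"
        by (rule tendsto_mult_left)
      show "\<exists>N. \<forall>n\<ge>N. l2norm M (\<lambda>x. partial_derivs bs (\<phi> n) x - partial_derivs bs (\<psi> n) x)
          \<le> K * l2norm M (\<lambda>x. laplacian (\<phi> n) x - laplacian (\<psi> n) x)"
        using bspec[OF bspec[OF K bs] test_diff(1)[OF \<phi> \<psi>]]
        unfolding test_diff(2)[OF \<phi> \<psi>] test_diff(3)[OF \<phi> \<psi> directions2_Basis[OF bs]] by (intro exI allI impI)
    qed
    have "H2_norm \<Omega> (class_diff \<Omega> U V) \<le> (\<Sum>bs\<in>directions2. l2norm M (\<lambda>x. D bs U x - D bs V x))"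
      unfolding H2_norm_class_diff[OF U V] by (rule L2_set_le_sum) simp
    also have "\<dots> \<le> (\<Sum>bs\<in>(directions2 :: 'a list set). K * l2norm M (\<lambda>x. laplacian_rep U x - laplacian_rep V x))"
      by (rule sum_mono[OF est])
    finally show ?thesis by simp
  qed
  then show ?thesis by blast
qed

lemma laplacian_rep_Lipschitz:
  assumes U: "U \<in> H2 \<Omega>" and V: "V \<in> H2 \<Omega>"
  shows "l2norm M (\<lambda>x. laplacian_rep U x - laplacian_rep V x) \<le> real DIM('a) * H2_norm \<Omega> (class_diff \<Omega> U V)"
proof -
  have tri: "l2norm M (\<lambda>x. \<Sum>i\<in>I. f i x) \<le> (\<Sum>i\<in>I. l2norm M (f i))"
    if "finite I" "\<And>i. i \<in> I \<Longrightarrow> square_integrable M (f i)" for f and I :: "'a set"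
    using that
  proof (induction I rule: finite_induct)
    case (insert j I)
    have "l2norm M (\<lambda>x. f j x + (\<Sum>i\<in>I. f i x)) \<le> l2norm M (f j) + l2norm M (\<lambda>x. \<Sum>i\<in>I. f i x)"
      by (intro l2norm_triangle square_integrable_sum insert.prems) auto
    with insert show ?case by simp
  qed (simp add: l2norm_def)
  have "(\<lambda>x. laplacian_rep U x - laplacian_rep V x) = (\<lambda>x. \<Sum>b\<in>Basis. D [b, b] U x - D [b, b] V x)"
    by (simp add: laplacian_rep_def sum_subtractf)
  then have "l2norm M (\<lambda>x. laplacian_rep U x - laplacian_rep V x) \<le> (\<Sum>b\<in>Basis. l2norm M (\<lambda>x. D [b, b] U x - D [b, b] V x))"
    using tri[of Basis "\<lambda>b x. D [b, b] U x - D [b, b] V x"]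
      square_integrable_diff[OF H2_weak_deriv(1)[OF U pair_directions2] H2_weak_deriv(1)[OF V pair_directions2]]
    by simp
  also have "\<dots> \<le> (\<Sum>b\<in>(Basis :: 'a set). H2_norm \<Omega> (class_diff \<Omega> U V))"
  proof (rule sum_mono)
    fix b :: 'a assume "b \<in> Basis"
    then show "l2norm M (\<lambda>x. D [b, b] U x - D [b, b] V x) \<le> H2_norm \<Omega> (class_diff \<Omega> U V)"
      unfolding H2_norm_class_diff[OF U V]
      by (intro member_le_L2_set[OF finite_directions2 pair_directions2])
  qed
  finally show ?thesis by simp
qed

text \<open>Harmonicity is tested against Laplacians of test functions, and these converge to the Laplacian
  of an element of \<open>H2_0\<close>.\<close>

lemma weak_laplacian_perp:
  assumes "U \<in> H2_0 \<Omega>" shows "weak_laplacian \<Omega> U \<in> harmonic_perp \<Omega>"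
proof -
  from assms obtain \<phi> where U: "U \<in> H2 \<Omega>" and c: "H2_approximates \<phi> U" by (auto simp: H2_0_iff)
  have \<phi>: "\<phi> n \<in> test_functions \<Omega>" for n using c by (simp add: H2_approximates_def)
  have "L2_inner \<Omega> (weak_laplacian \<Omega> U) V = 0" if V: "V \<in> harmonic_L2 \<Omega>" for V
  proof -
    have rV: "square_integrable M (rep V)" using V L2_cases(1)[of V \<Omega>] by (simp add: harmonic_L2_def)
    have "(LINT x|M. laplacian (\<phi> n) x * rep V x) = 0" for n
    proof -
      have "(LINT x|M. rep V x * laplacian (\<phi> n) x) = 0" using V \<phi> by (simp add: harmonic_L2_def)
      then show ?thesis by (simp add: mult.commute)
    qed
    moreover have "(\<lambda>n. LINT x|M. laplacian (\<phi> n) x * rep V x) \<longlonglongrightarrow> (LINT x|M. laplacian_rep U x * rep V x)"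
      by (intro integral_product_tendsto square_integrable_test test_function_laplacian \<phi>
          square_integrable_laplacian_rep U H2_approximates_laplacian c rV)
    ultimately have "(LINT x|M. laplacian_rep U x * rep V x) = 0" by (simp add: LIMSEQ_const_iff)
    then show ?thesis
      unfolding L2_inner_def weak_laplacian_eq
      using integral_rep_ae_class[OF square_integrable_measurable[OF square_integrable_laplacian_rep[OF U]]
          square_integrable_measurable[OF rV]] by simp
  qed
  then show ?thesis using weak_laplacian_L2[OF U] by (simp add: harmonic_perp_def)
qed

text \<open>If the Laplacians of test functions converge in \<open>L2\<close>, the a priori estimate makes all derivatives
  of order at most two Cauchy, and weak derivatives pass to the limit.\<close>

lemma laplacian_limit_attained:
  assumes \<phi>: "\<And>n. \<phi> n \<in> test_functions \<Omega>" and p: "square_integrable M p"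
    and lim: "(\<lambda>n. l2norm M (\<lambda>x. laplacian (\<phi> n) x - p x)) \<longlonglongrightarrow> 0"
  obtains U where "U \<in> H2_0 \<Omega>" "weak_laplacian \<Omega> U = ae_class \<Omega> p"
proof -
  obtain K where K0: "K \<ge> 0" and K: "\<forall>bs\<in>directions2. \<forall>\<phi>\<in>test_functions \<Omega>.
    l2norm M (partial_derivs bs \<phi>) \<le> K * l2norm M (laplacian \<phi>)"
    using laplacian_bounds_derivs by blast
  have sq: "square_integrable M (partial_derivs bs (\<phi> n))" if "bs \<in> directions2" for bs n
    by (intro square_integrable_test test_function_partial_derivs \<phi> directions2_Basis that)
  have sqL: "square_integrable M (laplacian (\<phi> n))" for n
    by (intro square_integrable_test test_function_laplacian \<phi>)
  have "\<exists>g. square_integrable M g \<and> (\<lambda>n. l2norm M (\<lambda>x. partial_derivs bs (\<phi> n) x - g x)) \<longlonglongrightarrow> 0"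
    if bs: "bs \<in> directions2" for bs
  proof -
    have "\<exists>N. \<forall>m\<ge>N. \<forall>n\<ge>N. l2norm M (\<lambda>x. partial_derivs bs (\<phi> m) x - partial_derivs bs (\<phi> n) x) < e"
      if e: "e > 0" for e
    proof -
      \<comment> \<open>\<open>K + 1\<close> instead of \<open>K\<close>, which may vanish.\<close>
      have e': "0 < e / (2 * (K + 1))" using e K0 by simp
      from LIMSEQ_D[OF lim e'] obtain N
        where N: "\<And>n. n \<ge> N \<Longrightarrow> l2norm M (\<lambda>x. laplacian (\<phi> n) x - p x) < e / (2 * (K + 1))" by auto
      have "l2norm M (\<lambda>x. partial_derivs bs (\<phi> m) x - partial_derivs bs (\<phi> n) x) < e"
        if "m \<ge> N" "n \<ge> N" for m n
      proof -
        let ?L = "l2norm M (\<lambda>x. laplacian (\<phi> m) x - laplacian (\<phi> n) x)"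
        have "l2norm M (\<lambda>x. partial_derivs bs (\<phi> m) x - partial_derivs bs (\<phi> n) x) \<le> K * ?L"
          using bspec[OF bspec[OF K bs] test_diff(1)[OF \<phi> \<phi>]]
          unfolding test_diff(2)[OF \<phi> \<phi>] test_diff(3)[OF \<phi> \<phi> directions2_Basis[OF bs]] .
        also have "\<dots> \<le> (K + 1) * ?L" by (intro mult_right_mono) auto
        also have "\<dots> < (K + 1) * (e / (K + 1))"
        proof (rule mult_strict_left_mono)
          have "?L < e / (2 * (K + 1)) + e / (2 * (K + 1))"
            using l2norm_triangle_diff[OF sqL p sqL, of m n] N[OF that(1)] N[OF that(2)]
              l2norm_minus_commute[of M p "laplacian (\<phi> n)"] by linarith
          also have "\<dots> = e / (K + 1)" 
            by (simp only: divide_divide_eq_left[symmetric] add_divide_distrib[symmetric]) simp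
          finally show "?L < e / (K + 1)" .
        qed (use K0 in simp)
        also have "\<dots> = e" using K0 by simp
        finally show ?thesis .
      qed
      then show ?thesis by blast
    qed
    from L2_complete[of "\<lambda>n. partial_derivs bs (\<phi> n)", OF sq[OF bs] this] show ?thesis by blast
  qed
  then obtain g where g: "\<And>bs. bs \<in> directions2 \<Longrightarrow> square_integrable M (g bs)"
    and glim: "\<And>bs. bs \<in> directions2 \<Longrightarrow> (\<lambda>n. l2norm M (\<lambda>x. partial_derivs bs (\<phi> n) x - g bs x)) \<longlonglongrightarrow> 0"
    by metis
  define u where "u = g []"
  have u: "square_integrable M u" unfolding u_def by (rule g[OF Nil_directions2])
  have weak: "weak_partial bs u (g bs)" if bs: "bs \<in> directions2" for bs
    unfolding weak_partial_def
  proof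
    fix \<psi> assume \<psi>: "\<psi> \<in> test_functions \<Omega>"
    have l1: "(\<lambda>n. LINT x|M. \<phi> n x * partial_derivs bs \<psi> x) \<longlonglongrightarrow> (LINT x|M. u x * partial_derivs bs \<psi> x)"
    proof (rule integral_product_tendsto[OF _ u])
      show "(\<lambda>n. l2norm M (\<lambda>x. \<phi> n x - u x)) \<longlonglongrightarrow> 0" using glim[OF Nil_directions2] by (simp add: u_def)
    qed (intro square_integrable_test test_function_partial_derivs \<phi> \<psi> directions2_Basis bs)+
    have l2: "(\<lambda>n. (-1) ^ length bs * (LINT x|M. partial_derivs bs (\<phi> n) x * \<psi> x))
        \<longlonglongrightarrow> (-1) ^ length bs * (LINT x|M. g bs x * \<psi> x)"
      by (intro tendsto_mult_left integral_product_tendsto sq g glim bs square_integrable_test \<psi>)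
    have eq: "(LINT x|M. \<phi> n x * partial_derivs bs \<psi> x)
        = (-1) ^ length bs * (LINT x|M. partial_derivs bs (\<phi> n) x * \<psi> x)" for n
      using weak_partial_test[OF \<phi> bs] \<psi> unfolding weak_partial_def by blast
    show "(LINT x|M. u x * partial_derivs bs \<psi> x) = (-1) ^ length bs * (LINT x|M. g bs x * \<psi> x)"
      by (rule LIMSEQ_unique[OF l1[unfolded eq] l2])
  qed
  have gw: "square_integrable M (g bs) \<and> weak_partial bs u (g bs)" if "bs \<in> directions2" for bs
    using g weak that by blast
  define U where "U = ae_class \<Omega> u"
  have U: "U \<in> H2 \<Omega>" unfolding U_def by (rule H2_I(1)[OF u gw])
  have DU: "AE x in M. D bs U x = g bs x" if bs: "bs \<in> directions2" for bs
  proof -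
    have "weak_deriv \<Omega> bs U = ae_class \<Omega> (g bs)"
      unfolding U_def using bs by (intro H2_I(2)[where g = g] u gw)
    then show ?thesis using rep_ae_class(2)[OF square_integrable_measurable[OF g[OF bs]]] by simp
  qed
  have c: "H2_approximates \<phi> U"
    unfolding H2_approximates_def
  proof (intro conjI ballI allI \<phi>)
    fix bs :: "'a list" assume bs: "bs \<in> directions2"
    have "l2norm M (\<lambda>x. partial_derivs bs (\<phi> n) x - D bs U x) = l2norm M (\<lambda>x. partial_derivs bs (\<phi> n) x - g bs x)" for n
    proof (rule l2norm_cong_AE)
      show "AE x in M. partial_derivs bs (\<phi> n) x - D bs U x = partial_derivs bs (\<phi> n) x - g bs x"
        using DU[OF bs] by eventually_elim simp
    qed (intro square_integrable_measurable square_integrable_diff sq g H2_weak_deriv(1) U bs)+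
    then show "(\<lambda>n. l2norm M (\<lambda>x. partial_derivs bs (\<phi> n) x - D bs U x)) \<longlonglongrightarrow> 0"
      using glim[OF bs] by simp
  qed
  have "(\<lambda>n. l2norm M (\<lambda>x. laplacian (\<phi> n) x - laplacian (\<phi> n) x)) \<longlonglongrightarrow> l2norm M (\<lambda>x. laplacian_rep U x - p x)"
    by (intro l2norm_diff_limit sqL square_integrable_laplacian_rep H2_approximates_laplacian U c p lim)
  then have "l2norm M (\<lambda>x. laplacian_rep U x - p x) = 0" by (simp add: l2norm_def LIMSEQ_const_iff)
  then have "weak_laplacian \<Omega> U = ae_class \<Omega> p"
    unfolding weak_laplacian_eq by (simp only: ae_class_eq_iff[OF square_integrable_laplacian_rep[OF U] p])
  moreover have "U \<in> H2_0 \<Omega>" using U c by (auto simp: H2_0_iff)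
  ultimately show thesis by (rule that[rotated])
qed

text \<open>Let \<open>p\<close> be the projection of \<open>F\<close> onto the closure of the Laplacians of test functions. The residual
  \<open>r = F - p\<close> is orthogonal to all those Laplacians, that is, harmonic; so it is orthogonal to \<open>F\<close>. It is
  also orthogonal to their limit \<open>p\<close>, hence to itself, and \<open>F = p\<close>.\<close>

lemma weak_laplacian_surj:
  assumes F: "F \<in> harmonic_perp \<Omega>"
  obtains U where "U \<in> H2_0 \<Omega>" "weak_laplacian \<Omega> U = F"
proof -
  have FL: "F \<in> L2 \<Omega>" using F by (simp add: harmonic_perp_def)
  note rF = L2_cases[OF FL]
  have "\<exists>s p. (\<forall>n. s n \<in> laplacian ` test_functions \<Omega>) \<and> square_integrable M p \<and>
    (\<lambda>n::nat. l2norm M (\<lambda>x. s n x - p x)) \<longlonglongrightarrow> 0 \<and>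
    (\<forall>t\<in>laplacian ` test_functions \<Omega>. (LINT x|M. (rep F x - p x) * t x) = 0)"
  proof (rule projection_onto_closure[OF rF(1), of "laplacian ` test_functions \<Omega>"])
    show "square_integrable M t" if "t \<in> laplacian ` test_functions \<Omega>" for t
      using that by (auto intro: square_integrable_test test_function_laplacian)
    have "laplacian (\<lambda>x. 0) = (\<lambda>x::'a. 0)"
      using laplacian_cmult[OF test_function_zero, of 0] by simp
    then show "(\<lambda>x. 0) \<in> laplacian ` test_functions \<Omega>" using test_function_zero by (metis image_eqI)
    show "(\<lambda>x. s x + t x) \<in> laplacian ` test_functions \<Omega>"
      if "s \<in> laplacian ` test_functions \<Omega>" "t \<in> laplacian ` test_functions \<Omega>" for s t
    proof -
      from that obtain \<phi> \<psi> where \<phi>: "\<phi> \<in> test_functions \<Omega>" "s = laplacian \<phi>"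
        and \<psi>: "\<psi> \<in> test_functions \<Omega>" "t = laplacian \<psi>" by blast
      have "laplacian (\<lambda>x. \<phi> x + \<psi> x) \<in> laplacian ` test_functions \<Omega>"
        by (intro imageI test_function_add \<phi>(1) \<psi>(1))
      then show ?thesis by (simp only: laplacian_add[OF \<phi>(1) \<psi>(1)] \<phi>(2) \<psi>(2))
    qed
    show "(\<lambda>x. c * t x) \<in> laplacian ` test_functions \<Omega>" if "t \<in> laplacian ` test_functions \<Omega>" for c t
    proof -
      from that obtain \<phi> where \<phi>: "\<phi> \<in> test_functions \<Omega>" "t = laplacian \<phi>" by blast
      have "laplacian (\<lambda>x. c * \<phi> x) \<in> laplacian ` test_functions \<Omega>"
        by (intro imageI test_function_cmult \<phi>(1))
      then show ?thesis by (simp only: laplacian_cmult[OF \<phi>(1)] \<phi>(2))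
    qed
  qed
  then obtain s p where s: "\<forall>n. s n \<in> laplacian ` test_functions \<Omega>" and p: "square_integrable M p"
    and lim: "(\<lambda>n::nat. l2norm M (\<lambda>x. s n x - p x)) \<longlonglongrightarrow> 0"
    and orth: "\<forall>t\<in>laplacian ` test_functions \<Omega>. (LINT x|M. (rep F x - p x) * t x) = 0"
    by blast
  have "\<forall>n. \<exists>\<phi>. \<phi> \<in> test_functions \<Omega> \<and> s n = laplacian \<phi>" using s by blast
  then obtain \<phi> where \<phi>: "\<And>n. \<phi> n \<in> test_functions \<Omega>" and s_eq: "\<And>n. s n = laplacian (\<phi> n)" by metis
  define r where "r x = rep F x - p x" for x
  have r: "square_integrable M r" unfolding r_def by (rule square_integrable_diff[OF rF(1) p])
  note mr = square_integrable_measurable[OF r]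
  have "ae_class \<Omega> r \<in> harmonic_L2 \<Omega>"
    unfolding harmonic_L2_def
  proof (intro CollectI conjI ballI ae_class_in_L2 r)
    fix \<psi> assume \<psi>: "\<psi> \<in> test_functions \<Omega>"
    have "(LINT x|M. r x * laplacian \<psi> x) = 0" unfolding r_def by (rule bspec[OF orth imageI[OF \<psi>]])
    then show "(LINT x|M. rep (ae_class \<Omega> r) x * laplacian \<psi> x) = 0"
      using integral_rep_ae_class[OF mr test_measurable[OF test_function_laplacian[OF \<psi>]]] by simp
  qed
  then have "L2_inner \<Omega> F (ae_class \<Omega> r) = 0" using F by (simp add: harmonic_perp_def)
  then have Fr: "(LINT x|M. rep F x * r x) = 0"
    using integral_rep_ae_class[OF mr square_integrable_measurable[OF rF(1)]]
    by (simp add: L2_inner_def mult.commute)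
  have "(LINT x|M. s n x * r x) = 0" for n
    using bspec[OF orth spec[OF s, of n]] by (simp add: r_def mult.commute)
  moreover have "(\<lambda>n. LINT x|M. s n x * r x) \<longlonglongrightarrow> (LINT x|M. p x * r x)"
    unfolding s_eq
    by (intro integral_product_tendsto square_integrable_test test_function_laplacian \<phi> p r lim[unfolded s_eq])
  ultimately have pr: "(LINT x|M. p x * r x) = 0" by (simp add: LIMSEQ_const_iff)
  have "(l2norm M r)\<^sup>2 = (LINT x|M. rep F x * r x - p x * r x)"
    unfolding l2norm_power2 by (simp add: r_def power2_eq_square left_diff_distrib)
  also have "\<dots> = 0"
    using Fr pr integrable_product[OF rF(1) r] integrable_product[OF p r] by simp
  finally have "l2norm M (\<lambda>x. rep F x - p x) = 0" by (simp add: r_def[abs_def])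
  then have "ae_class \<Omega> p = F" using ae_class_eq_iff[OF rF(1) p] rF(2) by simp
  with laplacian_limit_attained[OF \<phi> p lim[unfolded s_eq]] that show thesis by metis
qed

lemma weak_laplacian_inj:
  assumes U: "U \<in> H2_0 \<Omega>" and V: "V \<in> H2_0 \<Omega>" and eq: "weak_laplacian \<Omega> U = weak_laplacian \<Omega> V"
  shows "U = V"
proof -
  interpret H: Metric_space "H2 \<Omega>" "\<lambda>U V. H2_norm \<Omega> (class_diff \<Omega> U V)" by (rule Metric_space_H2)
  have UV: "U \<in> H2 \<Omega>" "V \<in> H2 \<Omega>" using U V by (simp_all add: H2_0_iff)
  have "l2norm M (\<lambda>x. laplacian_rep U x - laplacian_rep V x) = 0"
    using eq ae_class_eq_iff[OF square_integrable_laplacian_rep[OF UV(1)] square_integrable_laplacian_rep[OF UV(2)]]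
    by (simp add: weak_laplacian_eq)
  moreover obtain C where "H2_norm \<Omega> (class_diff \<Omega> U V) \<le> C * l2norm M (\<lambda>x. laplacian_rep U x - laplacian_rep V x)"
    using H2_0_estimate U V by blast
  ultimately have "H2_norm \<Omega> (class_diff \<Omega> U V) = 0" using H.nonneg[of U V] by simp
  then show ?thesis using UV by simp
qed

theorem weak_laplacian_iso:
  "linear_topological_iso \<Omega> (subtopology (H2_topology \<Omega>) (H2_0 \<Omega>))
     (subtopology (L2_topology \<Omega>) (harmonic_perp \<Omega>)) (weak_laplacian \<Omega>)"
proof -
  interpret H: Metric_space "H2 \<Omega>" "\<lambda>U V. H2_norm \<Omega> (class_diff \<Omega> U V)" by (rule Metric_space_H2)
  have sub: "H2_0 \<Omega> \<subseteq> H2 \<Omega>" by (auto simp: H2_0_iff)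
  have top: "topspace (subtopology (H2_topology \<Omega>) (H2_0 \<Omega>)) = H2_0 \<Omega>"
    using sub by (auto simp: H2_topology_def)
  obtain C where C: "\<forall>U\<in>H2_0 \<Omega>. \<forall>V\<in>H2_0 \<Omega>. H2_norm \<Omega> (class_diff \<Omega> U V) \<le> C * l2norm M (\<lambda>x. laplacian_rep U x - laplacian_rep V x)"
    using H2_0_estimate by blast
  have "homeomorphic_map (subtopology (H2_topology \<Omega>) (H2_0 \<Omega>))
     (subtopology (L2_topology \<Omega>) (harmonic_perp \<Omega>)) (weak_laplacian \<Omega>)"
    unfolding H2_topology_def L2_topology_def
  proof (rule homeomorphic_map_bi_Lipschitz[OF Metric_space_H2 Metric_space_L2 sub])
    show "harmonic_perp \<Omega> \<subseteq> L2 \<Omega>" by (auto simp: harmonic_perp_def)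
    show "bij_betw (weak_laplacian \<Omega>) (H2_0 \<Omega>) (harmonic_perp \<Omega>)"
    proof (rule bij_betw_imageI)
      show "inj_on (weak_laplacian \<Omega>) (H2_0 \<Omega>)" by (rule inj_onI) (rule weak_laplacian_inj)
      show "weak_laplacian \<Omega> ` H2_0 \<Omega> = harmonic_perp \<Omega>"
      proof
        show "weak_laplacian \<Omega> ` H2_0 \<Omega> \<subseteq> harmonic_perp \<Omega>" using weak_laplacian_perp by blast
        show "harmonic_perp \<Omega> \<subseteq> weak_laplacian \<Omega> ` H2_0 \<Omega>"
        proof
          fix F assume "F \<in> harmonic_perp \<Omega>"
          from weak_laplacian_surj[OF this] obtain U where "U \<in> H2_0 \<Omega>" "weak_laplacian \<Omega> U = F" by blast
          then show "F \<in> weak_laplacian \<Omega> ` H2_0 \<Omega>" by blast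
        qed
      qed
    qed
    fix U V assume UV: "U \<in> H2_0 \<Omega>" "V \<in> H2_0 \<Omega>"
    then have H: "U \<in> H2 \<Omega>" "V \<in> H2 \<Omega>" using sub by auto
    show "L2_norm \<Omega> (class_diff \<Omega> (weak_laplacian \<Omega> U) (weak_laplacian \<Omega> V))
        \<le> real DIM('a) * H2_norm \<Omega> (class_diff \<Omega> U V)"
      unfolding weak_laplacian_dist[OF H] by (rule laplacian_rep_Lipschitz[OF H])
    show "H2_norm \<Omega> (class_diff \<Omega> U V)
        \<le> C * L2_norm \<Omega> (class_diff \<Omega> (weak_laplacian \<Omega> U) (weak_laplacian \<Omega> V))"
      unfolding weak_laplacian_dist[OF H] by (rule bspec[OF bspec[OF C UV(1)] UV(2)])
  qed
  then show ?thesis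
    unfolding linear_topological_iso_def top
    using weak_laplacian_add weak_laplacian_scale sub by blast
qed

end

theorem mainTheorem9:
  fixes \<Omega> :: "(real ^ 'n) set"
  assumes "CARD('n) \<ge> 2"
    and "bounded_lipschitz_domain \<Omega>"
  shows "linear_topological_iso \<Omega>
           (subtopology (H2_topology \<Omega>) (H2_0 \<Omega>))
           (subtopology (L2_topology \<Omega>) (harmonic_perp \<Omega>))
           (weak_laplacian \<Omega>) \<and>
         (\<forall>F\<in>L2 \<Omega>. (\<forall>V\<in>harmonic_L2 \<Omega>. L2_inner \<Omega> F V = 0) \<longrightarrow>
           (\<exists>!U. U \<in> H2_0 \<Omega> \<and> weak_laplacian \<Omega> U = F))"
proof -
  interpret bounded_open \<Omega>
    using assms(2) by unfold_locales (simp_all add: bounded_lipschitz_domain_def)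
  show ?thesis
  proof (intro conjI weak_laplacian_iso ballI impI)
    fix F assume "F \<in> L2 \<Omega>" "\<forall>V\<in>harmonic_L2 \<Omega>. L2_inner \<Omega> F V = 0"
    then have "F \<in> harmonic_perp \<Omega>" by (simp add: harmonic_perp_def)
    from weak_laplacian_surj[OF this] obtain U where U: "U \<in> H2_0 \<Omega>" "weak_laplacian \<Omega> U = F" by blast
    then show "\<exists>!U. U \<in> H2_0 \<Omega> \<and> weak_laplacian \<Omega> U = F"
      using weak_laplacian_inj by (intro ex1I[of _ U]) auto
  qed
qed

end
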